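(* Let $n\geq 1$ and let $\mathbb{K}$ be a field. The semigroup algebra $\mathbb{K}\mathrm{K}_n$ is basic.
   Context: For a positive integer $n$, Kiselman's semigroup $\mathrm{K}_n$ is the monoid (with unit element $e$) given by the monoid presentation with generators $a_1,\dots,a_n$ and relations $a_i^2=a_i$ for $i=1,\dots,n$, and $a_ia_ja_i=a_ja_ia_j=a_ja_i$ for all $1\leq i<j\leq n$. $\mathbb{K}\mathrm{K}_n$ is its semigroup algebra over $\mathbb{K}$ (finite-dimensional, since $\mathrm{K}_n$ is finite). A finite-dimensional algebra $A$ is basic if $A/\mathrm{rad}(A)$ is a direct product of division algebras; equivalently, in a decomposition of the regular module into indecomposable projectives the summands are pairwise non-isomorphic. *)

theory Defs
  imports "HOL-Algebra.QuotRing" "HOL-Algebra.Module"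
begin

section \<open>Monoid presentations and Kiselman's semigroup\<close>

inductive_set presentation_cong :: "'g set \<Rightarrow> ('g list \<times> 'g list) set \<Rightarrow> ('g list \<times> 'g list) set"
  for X :: "'g set" and R :: "('g list \<times> 'g list) set" where
    refl: "w \<in> lists X \<Longrightarrow> (w, w) \<in> presentation_cong X R"
  | sym: "(u, v) \<in> presentation_cong X R \<Longrightarrow> (v, u) \<in> presentation_cong X R"
  | trans: "\<lbrakk>(u, v) \<in> presentation_cong X R; (v, w) \<in> presentation_cong X R\<rbrakk>
      \<Longrightarrow> (u, w) \<in> presentation_cong X R"
  | rel: "\<lbrakk>(u, v) \<in> R; u \<in> lists X; v \<in> lists X; p \<in> lists X; q \<in> lists X\<rbrakk>
      \<Longrightarrow> (p @ u @ q, p @ v @ q) \<in> presentation_cong X R"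

definition presented_monoid :: "'g set \<Rightarrow> ('g list \<times> 'g list) set \<Rightarrow> 'g list set monoid" where
  "presented_monoid X R =
    \<lparr>carrier = lists X // presentation_cong X R,
     mult = (\<lambda>A B. \<Union>u\<in>A. \<Union>v\<in>B. presentation_cong X R `` {u @ v}),
     one = presentation_cong X R `` {[]}\<rparr>"

text \<open>The letter \<open>i\<close> stands for the generator \<open>a\<^sub>i\<close>.\<close>

definition kiselman_relations :: "nat \<Rightarrow> (nat list \<times> nat list) set" where
  "kiselman_relations n =
     {([i, i], [i]) | i. 1 \<le> i \<and> i \<le> n} \<union>
     {([i, j, i], [j, i]) | i j. 1 \<le> i \<and> i < j \<and> j \<le> n} \<union>
     {([j, i, j], [j, i]) | i j. 1 \<le> i \<and> i < j \<and> j \<le> n}"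

definition kiselman_monoid :: "nat \<Rightarrow> nat list set monoid" where
  "kiselman_monoid n = presented_monoid {1..n} (kiselman_relations n)"

lemma presentation_cong_in_lists:
  assumes "(u, v) \<in> presentation_cong X R"
  shows "u \<in> lists X \<and> v \<in> lists X"
  using assms by induction auto

lemma equiv_presentation_cong: "equiv (lists X) (presentation_cong X R)"
proof (rule equivI)
  show "presentation_cong X R \<subseteq> lists X \<times> lists X"
    using presentation_cong_in_lists by fast
  show "refl_on (lists X) (presentation_cong X R)"
    by (simp add: refl_on_def presentation_cong.refl)
  show "sym (presentation_cong X R)"
    by (rule symI) (rule presentation_cong.sym)
  show "trans (presentation_cong X R)"
    by (rule transI) (rule presentation_cong.trans)
qed

lemma presentation_cong_append:
  assumes "(u, v) \<in> presentation_cong X R" "p \<in> lists X" "q \<in> lists X"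
  shows "(p @ u @ q, p @ v @ q) \<in> presentation_cong X R"
  using assms(1)
proof induction
  case (refl w)
  then show ?case using assms by (intro presentation_cong.refl) auto
next
  case (rel u v p' q')
  then have "((p @ p') @ u @ (q' @ q), (p @ p') @ v @ (q' @ q)) \<in> presentation_cong X R"
    using assms by (intro presentation_cong.rel) auto
  then show ?case by simp
next
  case (sym u v)
  from sym.IH show ?case by (rule presentation_cong.sym)
next
  case (trans u v w)
  from trans.IH show ?case by (rule presentation_cong.trans)
qed

lemma presented_monoid_mult:
  assumes "u \<in> lists X" "v \<in> lists X"
  shows "(presentation_cong X R `` {u}) \<otimes>\<^bsub>presented_monoid X R\<^esub> (presentation_cong X R `` {v})
       = presentation_cong X R `` {u @ v}"
proof -
  have "(u @ v, u' @ v') \<in> presentation_cong X R"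
    if "(u, u') \<in> presentation_cong X R" "(v, v') \<in> presentation_cong X R" for u' v'
  proof (rule presentation_cong.trans)
    show "(u @ v, u' @ v) \<in> presentation_cong X R"
      using presentation_cong_append[OF that(1), of "[]" v] assms by simp
    show "(u' @ v, u' @ v') \<in> presentation_cong X R"
      using presentation_cong_append[OF that(2), of u' "[]"] presentation_cong_in_lists[OF that(1)]
      by simp
  qed
  then have class_eq: "presentation_cong X R `` {u' @ v'} = presentation_cong X R `` {u @ v}"
    if "(u, u') \<in> presentation_cong X R" "(v, v') \<in> presentation_cong X R" for u' v'
    using that equiv_class_eq[OF equiv_presentation_cong] by metis
  let ?U = "presentation_cong X R `` {u}" and ?V = "presentation_cong X R `` {v}"
  have "?U \<noteq> {}" "?V \<noteq> {}"
    using presentation_cong.refl[OF assms(1)] presentation_cong.refl[OF assms(2)] by blast+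
  have "?U \<otimes>\<^bsub>presented_monoid X R\<^esub> ?V
      = (\<Union>u'\<in>?U. \<Union>v'\<in>?V. presentation_cong X R `` {u' @ v'})"
    by (simp add: presented_monoid_def)
  also have "\<dots> = (\<Union>u'\<in>?U. \<Union>v'\<in>?V. presentation_cong X R `` {u @ v})"
    by (intro SUP_cong class_eq HOL.refl) (simp_all only: Image_singleton_iff)
  also have "\<dots> = presentation_cong X R `` {u @ v}"
    using \<open>?U \<noteq> {}\<close> \<open>?V \<noteq> {}\<close> by (simp only: UN_constant if_False)
  finally show ?thesis .
qed

lemma monoid_presented_monoid: "monoid (presented_monoid X R)"
proof -
  let ?c = "\<lambda>w. presentation_cong X R `` {w}"
  have carr: "x \<in> carrier (presented_monoid X R) \<longleftrightarrow> (\<exists>w\<in>lists X. x = ?c w)" for x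
    by (auto simp: presented_monoid_def quotient_def)
  have one: "\<one>\<^bsub>presented_monoid X R\<^esub> = ?c []"
    by (simp add: presented_monoid_def)
  have append: "u @ v \<in> lists X" if "u \<in> lists X" "v \<in> lists X" for u v
    using that by simp
  have nil: "[] \<in> lists X"
    by simp
  show ?thesis
  proof (rule monoidI)
    show "\<one>\<^bsub>presented_monoid X R\<^esub> \<in> carrier (presented_monoid X R)"
      unfolding carr one using nil by blast
  next
    fix x y
    assume "x \<in> carrier (presented_monoid X R)" "y \<in> carrier (presented_monoid X R)"
    then obtain u v where "u \<in> lists X" "x = ?c u" "v \<in> lists X" "y = ?c v"
      unfolding carr by blast
    then have "x \<otimes>\<^bsub>presented_monoid X R\<^esub> y = ?c (u @ v)" "u @ v \<in> lists X"
      by (simp_all only: presented_monoid_mult append)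
    then show "x \<otimes>\<^bsub>presented_monoid X R\<^esub> y \<in> carrier (presented_monoid X R)"
      unfolding carr by (rule bexI)
  next
    fix x y z
    assume "x \<in> carrier (presented_monoid X R)" "y \<in> carrier (presented_monoid X R)"
      "z \<in> carrier (presented_monoid X R)"
    then obtain u v w where "u \<in> lists X" "x = ?c u" "v \<in> lists X" "y = ?c v"
      "w \<in> lists X" "z = ?c w"
      unfolding carr by blast
    then show "x \<otimes>\<^bsub>presented_monoid X R\<^esub> y \<otimes>\<^bsub>presented_monoid X R\<^esub> z
        = x \<otimes>\<^bsub>presented_monoid X R\<^esub> (y \<otimes>\<^bsub>presented_monoid X R\<^esub> z)"
      by (simp only: presented_monoid_mult append append_assoc)
  next
    fix x
    assume "x \<in> carrier (presented_monoid X R)"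
    then obtain u where "u \<in> lists X" "x = ?c u"
      unfolding carr by blast
    then show "\<one>\<^bsub>presented_monoid X R\<^esub> \<otimes>\<^bsub>presented_monoid X R\<^esub> x = x"
      and "x \<otimes>\<^bsub>presented_monoid X R\<^esub> \<one>\<^bsub>presented_monoid X R\<^esub> = x"
      by (simp_all only: one presented_monoid_mult nil append_Nil append_Nil2)
  qed
qed


section \<open>Associative unital algebras and semigroup algebras\<close>

text \<open>The library's locale \<^locale>\<open>algebra\<close> covers commutative algebras only.\<close>

locale unital_algebra = module R A + ring A for R (structure) and A (structure) +
  assumes smult_mult_left:
      "\<lbrakk>a \<in> carrier R; x \<in> carrier A; y \<in> carrier A\<rbrakk> \<Longrightarrow>
       (a \<odot>\<^bsub>A\<^esub> x) \<otimes>\<^bsub>A\<^esub> y = a \<odot>\<^bsub>A\<^esub> (x \<otimes>\<^bsub>A\<^esub> y)"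
    and smult_mult_right:
      "\<lbrakk>a \<in> carrier R; x \<in> carrier A; y \<in> carrier A\<rbrakk> \<Longrightarrow>
       x \<otimes>\<^bsub>A\<^esub> (a \<odot>\<^bsub>A\<^esub> y) = a \<odot>\<^bsub>A\<^esub> (x \<otimes>\<^bsub>A\<^esub> y)"

locale finite_dimensional_algebra = unital_algebra K A + field K
  for K (structure) and A (structure) +
  assumes finitely_spanned:
    "\<exists>B. finite B \<and> B \<subseteq> carrier A \<and>
       (\<forall>x\<in>carrier A. \<exists>c\<in>B \<rightarrow> carrier K. x = (\<Oplus>\<^bsub>A\<^esub>b\<in>B. c b \<odot>\<^bsub>A\<^esub> b))"

text \<open>Since \<open>\<zero>\<close> is a unit of the zero ring, the next condition excludes the zero algebra.\<close>

locale division_algebra = unital_algebra K D + field K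
  for K (structure) and D (structure) +
  assumes division: "Units D = carrier D - {\<zero>\<^bsub>D\<^esub>}"

definition semigroup_algebra ::
  "('k, 'm) ring_scheme \<Rightarrow> ('s, 'n) monoid_scheme \<Rightarrow> ('k, 's \<Rightarrow> 'k) module" where
  "semigroup_algebra K S =
    \<lparr>carrier = {f \<in> carrier S \<rightarrow>\<^sub>E carrier K. finite {s \<in> carrier S. f s \<noteq> \<zero>\<^bsub>K\<^esub>}},
     mult = (\<lambda>f g. \<lambda>s\<in>carrier S.
       \<Oplus>\<^bsub>K\<^esub>p \<in> {p \<in> carrier S \<times> carrier S. f (fst p) \<noteq> \<zero>\<^bsub>K\<^esub> \<and> g (snd p) \<noteq> \<zero>\<^bsub>K\<^esub>
                   \<and> fst p \<otimes>\<^bsub>S\<^esub> snd p = s}. f (fst p) \<otimes>\<^bsub>K\<^esub> g (snd p)),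
     one = (\<lambda>s\<in>carrier S. if s = \<one>\<^bsub>S\<^esub> then \<one>\<^bsub>K\<^esub> else \<zero>\<^bsub>K\<^esub>),
     zero = (\<lambda>s\<in>carrier S. \<zero>\<^bsub>K\<^esub>),
     add = (\<lambda>f g. \<lambda>s\<in>carrier S. f s \<oplus>\<^bsub>K\<^esub> g s),
     smult = (\<lambda>a f. \<lambda>s\<in>carrier S. a \<otimes>\<^bsub>K\<^esub> f s)\<rparr>"


section \<open>Basic algebras\<close>

definition left_ideal :: "'a set \<Rightarrow> ('a, 'm) ring_scheme \<Rightarrow> bool" where
  "left_ideal I R \<longleftrightarrow> additive_subgroup I R \<and> (\<forall>a\<in>carrier R. \<forall>x\<in>I. a \<otimes>\<^bsub>R\<^esub> x \<in> I)"

definition maximal_left_ideal :: "'a set \<Rightarrow> ('a, 'm) ring_scheme \<Rightarrow> bool" where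
  "maximal_left_ideal I R \<longleftrightarrow> left_ideal I R \<and> I \<noteq> carrier R \<and>
     (\<forall>J. left_ideal J R \<and> I \<subseteq> J \<longrightarrow> J = I \<or> J = carrier R)"

definition jacobson_radical :: "('a, 'm) ring_scheme \<Rightarrow> 'a set" where
  "jacobson_radical R = {x \<in> carrier R. \<forall>I. maximal_left_ideal I R \<longrightarrow> x \<in> I}"

definition quotient_algebra :: "('k, 'a, 'm) module_scheme \<Rightarrow> 'a set \<Rightarrow> ('k, 'a set) module" where
  "quotient_algebra A I = ring.extend (A Quot I)
     \<lparr>smult = (\<lambda>a X. \<Union>x\<in>X. I +>\<^bsub>A\<^esub> (a \<odot>\<^bsub>A\<^esub> x))\<rparr>"

definition product_algebra ::
  "'i set \<Rightarrow> ('i \<Rightarrow> ('k, 'a, 'm) module_scheme) \<Rightarrow> ('k, 'i \<Rightarrow> 'a) module" where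
  "product_algebra I D =
    \<lparr>carrier = (\<Pi>\<^sub>E i\<in>I. carrier (D i)),
     mult = (\<lambda>x y. \<lambda>i\<in>I. x i \<otimes>\<^bsub>D i\<^esub> y i),
     one = (\<lambda>i\<in>I. \<one>\<^bsub>D i\<^esub>),
     zero = (\<lambda>i\<in>I. \<zero>\<^bsub>D i\<^esub>),
     add = (\<lambda>x y. \<lambda>i\<in>I. x i \<oplus>\<^bsub>D i\<^esub> y i),
     smult = (\<lambda>a x. \<lambda>i\<in>I. a \<odot>\<^bsub>D i\<^esub> x i)\<rparr>"

definition algebra_iso ::
  "('k, 'n) ring_scheme \<Rightarrow> ('k, 'a, 'm) module_scheme \<Rightarrow> ('k, 'b, 'l) module_scheme \<Rightarrow> ('a \<Rightarrow> 'b) set"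
  where "algebra_iso K A B = {h \<in> ring_iso A B.
    \<forall>a\<in>carrier K. \<forall>x\<in>carrier A. h (a \<odot>\<^bsub>A\<^esub> x) = a \<odot>\<^bsub>B\<^esub> h x}"

text \<open>
  The division algebras \<open>D i\<close> are sought with elements of the same type as those of the quotient.
  This is no restriction: every factor of a product decomposition of the quotient is
  isomorphic to one carried by a subset of the quotient, namely the ideal corresponding to that
  factor, with the corresponding central idempotent as its unit element.
\<close>

definition basic_algebra :: "('k, 'n) ring_scheme \<Rightarrow> ('k, 'a, 'm) module_scheme \<Rightarrow> bool" where
  "basic_algebra K A \<longleftrightarrow> finite_dimensional_algebra K A \<and>
     (\<exists>(m :: nat) (D :: nat \<Rightarrow> ('k, 'a set) module).
        (\<forall>i<m. division_algebra K (D i)) \<and>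
        algebra_iso K (quotient_algebra A (jacobson_radical A)) (product_algebra {..<m} D) \<noteq> {})"

end

theory Submission
  imports Defs
begin

text \<open>
  The content of an element of Kiselman's semigroup \<open>S\<close> is the set of letters of any word
  representing it. It is additive, so every \<open>X \<subseteq> {1, \<dots>, n}\<close> gives a character \<open>chi X\<close> of the
  algebra: the one sending \<open>s\<close> to \<open>1\<close> if the content of \<open>s\<close> lies in \<open>X\<close> and to \<open>0\<close>
  otherwise. These characters are jointly surjective onto a power of the field, and their
  kernels are maximal left ideals, so it remains to see that the intersection \<open>N\<close> of the kernels lies
  in the radical. The key property of \<open>S\<close> is that \<open>s t = s\<close> implies \<open>s u = s\<close> for all \<open>u\<close> whose
  content lies in that of \<open>t\<close>. It makes right multiplication by an element of \<open>N\<close> map each basis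
  element \<open>s\<close> into the span of elements of \<open>s S\<close> generating a strictly smaller right ideal,
  so \<open>1 - b\<close> generates the unit left ideal for every \<open>b\<close> in \<open>N\<close>.
\<close>

section \<open>Words in Kiselman's semigroup\<close>

abbreviation kiselman_class :: "nat \<Rightarrow> nat list \<Rightarrow> nat list set" where
  "kiselman_class n w \<equiv> presentation_cong {1..n} (kiselman_relations n) `` {w}"

text \<open>The hypothesis on \<open>u\<close> matters: a word with a foreign letter has the empty
  class, so equality of classes yields congruence only when the class is known to contain its own
  representative.\<close>

lemma kiselman_class_eq_iff:
  assumes "u \<in> lists {1..n}"
  shows "kiselman_class n u = kiselman_class n v \<longleftrightarrow>
    (u, v) \<in> presentation_cong {1..n} (kiselman_relations n)"
proof
  assume "kiselman_class n u = kiselman_class n v"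
  moreover have "u \<in> kiselman_class n u"
    using assms by (auto intro: presentation_cong.refl)
  ultimately show "(u, v) \<in> presentation_cong {1..n} (kiselman_relations n)"
    by (auto intro: presentation_cong.sym)
next
  assume "(u, v) \<in> presentation_cong {1..n} (kiselman_relations n)"
  then show "kiselman_class n u = kiselman_class n v"
    using equiv_class_eq[OF equiv_presentation_cong] by metis
qed

lemma kiselman_class_cong:
  assumes "kiselman_class n u = kiselman_class n v"
    and "u \<in> lists {1..n}" "p \<in> lists {1..n}" "q \<in> lists {1..n}"
  shows "kiselman_class n (p @ u @ q) = kiselman_class n (p @ v @ q)"
proof -
  have "(u, v) \<in> presentation_cong {1..n} (kiselman_relations n)"
    using assms kiselman_class_eq_iff by blast
  then have "(p @ u @ q, p @ v @ q) \<in> presentation_cong {1..n} (kiselman_relations n)"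
    using assms(3,4) by (rule presentation_cong_append)
  then show ?thesis
    using equiv_class_eq[OF equiv_presentation_cong] by metis
qed

lemma kiselman_class_relation:
  assumes "(u, v) \<in> kiselman_relations n"
  shows "kiselman_class n u = kiselman_class n v"
proof -
  have "u \<in> lists {1..n}" "v \<in> lists {1..n}"
    using assms by (auto simp: kiselman_relations_def)
  then have "([] @ u @ [], [] @ v @ []) \<in> presentation_cong {1..n} (kiselman_relations n)"
    using assms by (intro presentation_cong.rel) auto
  then show ?thesis
    using equiv_class_eq[OF equiv_presentation_cong] by simp
qed

section \<open>Defining relations and absorption of repeated letters\<close>

lemma kiselman_class_idem:
  "i \<in> {1..n} \<Longrightarrow> kiselman_class n [i, i] = kiselman_class n [i]"
  by (rule kiselman_class_relation) (auto simp: kiselman_relations_def)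

text \<open>Allowing \<open>i = j\<close>, where both equations follow from idempotence, spares the
  inductions below a case distinction.\<close>

lemma kiselman_class_triple:
  assumes "i \<in> {1..n}" "j \<in> {1..n}" "i \<le> j"
  shows "kiselman_class n [i, j, i] = kiselman_class n [j, i]"
    and "kiselman_class n [j, i, j] = kiselman_class n [j, i]"
proof -
  have "kiselman_class n [i, j, i] = kiselman_class n [j, i] \<and>
    kiselman_class n [j, i, j] = kiselman_class n [j, i]"
  proof (cases "i = j")
    case True
    then show ?thesis
      using kiselman_class_cong[OF kiselman_class_idem, of i n "[i]" "[]"] assms by simp
  next
    case False
    then have "([i, j, i], [j, i]) \<in> kiselman_relations n" "([j, i, j], [j, i]) \<in> kiselman_relations n"
      using assms by (auto simp: kiselman_relations_def)
    then show ?thesis by (intro conjI kiselman_class_relation)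
  qed
  then show "kiselman_class n [i, j, i] = kiselman_class n [j, i]"
    and "kiselman_class n [j, i, j] = kiselman_class n [j, i]" by auto
qed

text \<open>The induction hypothesis lets an \<open>i\<close> be inserted before the last letter
  \<open>x\<close>; since \<open>x \<le> i\<close>, the relation \<open>i x i = i x\<close> removes
  the final \<open>i\<close>, and the inserted one is withdrawn again.\<close>

lemma kiselman_class_absorb_right:
  assumes "i \<in> {1..n}" "u \<in> lists {1..n}" "\<forall>x\<in>set u. x \<le> i"
  shows "kiselman_class n (i # u @ [i]) = kiselman_class n (i # u)"
  using assms(2,3)
proof (induction u rule: rev_induct)
  case Nil
  then show ?case using kiselman_class_idem[OF assms(1)] by simp
next
  case (snoc x v)
  then have x: "x \<in> {1..n}" "x \<le> i" and v: "v \<in> lists {1..n}"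
    and IH: "kiselman_class n (i # v @ [i]) = kiselman_class n (i # v)" by auto
  have "kiselman_class n (i # v @ [x, i]) = kiselman_class n ((i # v) @ [i, x, i])"
    using kiselman_class_cong[OF IH, of "[]" "[x, i]"] x v assms(1) by simp
  also have "\<dots> = kiselman_class n ((i # v) @ [i, x])"
    using kiselman_class_cong[OF kiselman_class_triple(2)[OF x(1) assms(1) x(2)], of "i # v" "[]"]
      x v assms(1) by simp
  also have "\<dots> = kiselman_class n (i # v @ [x])"
    using kiselman_class_cong[OF IH, of "[]" "[x]"] x v assms(1) by simp
  finally show ?case by simp
qed

text \<open>Dual argument: \<open>i x i = x i\<close> for \<open>i \<le> x\<close> deletes the
  leading \<open>i\<close> once the induction hypothesis has supplied an \<open>i\<close> after
  \<open>x\<close>.\<close>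

lemma kiselman_class_absorb_left:
  assumes "i \<in> {1..n}" "u \<in> lists {1..n}" "\<forall>x\<in>set u. i \<le> x"
  shows "kiselman_class n (i # u @ [i]) = kiselman_class n (u @ [i])"
  using assms(2,3)
proof (induction u)
  case Nil
  then show ?case using kiselman_class_idem[OF assms(1)] by simp
next
  case (Cons x v)
  then have x: "x \<in> {1..n}" "i \<le> x" and v: "v \<in> lists {1..n}"
    and IH: "kiselman_class n (i # v @ [i]) = kiselman_class n (v @ [i])" by auto
  have "kiselman_class n ([i, x] @ v @ [i]) = kiselman_class n ([i, x, i] @ v @ [i])"
    using kiselman_class_cong[OF IH, of "[i, x]" "[]"] x v assms(1) by simp
  also have "\<dots> = kiselman_class n ([x, i] @ v @ [i])"
    using kiselman_class_cong[OF kiselman_class_triple(1)[OF assms(1) x], of "[]" "v @ [i]"]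
      x v assms(1) by simp
  also have "\<dots> = kiselman_class n (x # v @ [i])"
    using kiselman_class_cong[OF IH, of "[x]" "[]"] x v assms(1) by simp
  finally show ?case by simp
qed

text \<open>Each later \<open>i\<close> is absorbed by the leading one, because only letters at most
  \<open>i\<close> lie between; thus a largest letter counts only at its first occurrence.\<close>

lemma kiselman_class_filter_right:
  assumes "i \<in> {1..n}" "u \<in> lists {1..n}" "\<forall>x\<in>set u. x \<le> i"
  shows "kiselman_class n (i # u) = kiselman_class n (i # filter (\<lambda>x. x \<noteq> i) u)"
  using assms(2,3)
proof (induction u rule: rev_induct)
  case (snoc x v)
  then have x: "x \<in> {1..n}" and v: "v \<in> lists {1..n}" "\<forall>x\<in>set v. x \<le> i"
    and IH: "kiselman_class n (i # v) = kiselman_class n (i # filter (\<lambda>x. x \<noteq> i) v)" by auto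
  show ?case
  proof (cases "x = i")
    case True
    then show ?thesis using kiselman_class_absorb_right[OF assms(1) v] IH by simp
  next
    case False
    then show ?thesis
      using kiselman_class_cong[OF IH, of "[]" "[x]"] x v assms(1) by simp
  qed
qed simp

lemma kiselman_class_filter_left:
  assumes "i \<in> {1..n}" "u \<in> lists {1..n}" "\<forall>x\<in>set u. i \<le> x"
  shows "kiselman_class n (u @ [i]) = kiselman_class n (filter (\<lambda>x. x \<noteq> i) u @ [i])"
  using assms(2,3)
proof (induction u)
  case (Cons x v)
  then have x: "x \<in> {1..n}" and v: "v \<in> lists {1..n}" "\<forall>x\<in>set v. i \<le> x"
    and IH: "kiselman_class n (v @ [i]) = kiselman_class n (filter (\<lambda>x. x \<noteq> i) v @ [i])" by auto
  show ?case
  proof (cases "x = i")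
    case True
    then show ?thesis using kiselman_class_absorb_left[OF assms(1) v] IH by simp
  next
    case False
    then show ?thesis
      using kiselman_class_cong[OF IH, of "[x]" "[]"] x v assms(1) by simp
  qed
qed simp

section \<open>Monoid operations and finiteness\<close>

lemma kiselman_class_mult:
  assumes "u \<in> lists {1..n}" "v \<in> lists {1..n}"
  shows "kiselman_class n u \<otimes>\<^bsub>kiselman_monoid n\<^esub> kiselman_class n v = kiselman_class n (u @ v)"
  using presented_monoid_mult[OF assms] by (simp add: kiselman_monoid_def)

lemma carrier_kiselman_monoid: "carrier (kiselman_monoid n) = kiselman_class n ` lists {1..n}"
  by (auto simp: kiselman_monoid_def presented_monoid_def quotient_def)

lemma one_kiselman_monoid: "\<one>\<^bsub>kiselman_monoid n\<^esub> = kiselman_class n []"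
  by (simp add: kiselman_monoid_def presented_monoid_def)

text \<open>
  Only the last occurrence of the smallest letter of a word matters, so the words in the letters
  \<open>k, \<dots>, n\<close> represent elements of \<open>G \<union> G a\<^sub>k G\<close>, where \<open>G\<close> belongs to the letters \<open>k + 1, \<dots>, n\<close>.
\<close>

lemma finite_carrier_kiselman_monoid: "finite (carrier (kiselman_monoid n))"
proof -
  \<comment> \<open>Downward induction on the least letter allowed: for \<open>k = Suc n\<close>
    only the empty word remains, and \<open>k = 1\<close> gives the whole carrier.\<close>
  have "finite (kiselman_class n ` lists {k..n})" if "1 \<le> k" "k \<le> Suc n" for k
    using that(2,1)
  proof (induction k rule: inc_induct)
    case base
    show ?case by simp
  next
    case (step k)
    let ?G = "kiselman_class n ` lists {Suc k..n}"
    have k: "k \<in> {1..n}" using step by simp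
    have sub: "lists {k..n} \<subseteq> lists {1..n}" "lists {Suc k..n} \<subseteq> lists {1..n}"
      using step by (auto intro!: lists_mono)
    have "kiselman_class n w \<in> ?G \<union> (\<lambda>(A, B). A \<otimes>\<^bsub>kiselman_monoid n\<^esub>
        (kiselman_class n [k] \<otimes>\<^bsub>kiselman_monoid n\<^esub> B)) ` (?G \<times> ?G)" (is "_ \<in> _ \<union> ?H")
      if w: "w \<in> lists {k..n}" for w
    proof (cases "k \<in> set w")
      case False
      then have "\<forall>x\<in>set w. Suc k \<le> x \<and> x \<le> n"
        using w by (metis Suc_leI atLeastAtMost_iff in_listsD le_neq_implies_less)
      then have "w \<in> lists {Suc k..n}" by auto
      then show ?thesis by blast
    next
      case True
      then obtain p q where pq: "w = p @ k # q" "k \<notin> set q"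
        by (meson split_list_last)
      define p' where "p' = filter (\<lambda>x. x \<noteq> k) p"
      have *: "\<forall>x\<in>set w. k \<le> x \<and> x \<le> n" using w by auto
      have p': "p' \<in> lists {Suc k..n}"
        using * pq by (auto simp: p'_def Suc_le_eq le_neq_implies_less)
      have "Suc k \<le> x \<and> x \<le> n" if "x \<in> set q" for x
        using * pq that by (metis Suc_leI Un_iff insert_iff le_neq_implies_less list.simps(15) set_append)
      then have q: "q \<in> lists {Suc k..n}" by auto
      have p: "p \<in> lists {1..n}" "\<forall>x\<in>set p. k \<le> x" using sub w pq * by auto
      have "kiselman_class n w = kiselman_class n (p' @ [k] @ q)"
        using kiselman_class_cong[OF kiselman_class_filter_left[OF k p], of "[]" q] sub q k p
        by (auto simp: pq p'_def)
      also have "\<dots> = kiselman_class n p' \<otimes>\<^bsub>kiselman_monoid n\<^esub>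
        (kiselman_class n [k] \<otimes>\<^bsub>kiselman_monoid n\<^esub> kiselman_class n q)"
      proof -
        have "[k] \<in> lists {1..n}" "p' \<in> lists {1..n}" "q \<in> lists {1..n}" "[k] @ q \<in> lists {1..n}"
          using k p' q sub by auto
        then show ?thesis by (simp only: kiselman_class_mult)
      qed
      finally have "kiselman_class n w \<in> ?H" using p' q by blast
      then show ?thesis by blast
    qed
    then have "kiselman_class n ` lists {k..n} \<subseteq> ?G \<union> ?H" by blast
    moreover have "finite ?G" using step by simp
    ultimately show ?case by (meson finite_SigmaI finite_UnI finite_imageI finite_subset)
  qed
  from this[of 1] show ?thesis by (simp add: carrier_kiselman_monoid)
qed

section \<open>Content and right stabilizers\<close>

lemma kiselman_cong_set_eq:
  assumes "(u, v) \<in> presentation_cong {1..n} (kiselman_relations n)"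
  shows "set u = set v"
  using assms by induction (auto simp: kiselman_relations_def)

text \<open>Both sides of every relation use the same letters, so all representatives agree on their
  letter set. The union over the class gives this set without choosing a representative.\<close>

lemma Union_set_kiselman_class:
  assumes "w \<in> lists {1..n}"
  shows "\<Union> (set ` kiselman_class n w) = set w"
  using presentation_cong.refl[OF assms] kiselman_cong_set_eq by fast

lemma kiselman_class_fixed_by_letters:
  assumes "s \<in> lists {1..n}" "t \<in> lists {1..n}"
    and "kiselman_class n (s @ t) = kiselman_class n s" and "x \<in> set t"
  shows "kiselman_class n (s @ [x]) = kiselman_class n s"
  using assms(2-4)
proof (induction "card (set t)" arbitrary: t rule: less_induct)
  case less
  define j where "j = Max (set t)"
  define t' where "t' = filter (\<lambda>x. x \<noteq> j) t"
  have "set t \<noteq> {}" using less by auto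
  then have j: "j \<in> set t" "\<forall>y\<in>set t. y \<le> j" by (auto simp: j_def)
  have jn: "j \<in> {1..n}" using j less by auto
  have t': "set t' = set t - {j}" "t' \<in> lists {1..n}" using less by (auto simp: t'_def)
  obtain p q where pq: "t = p @ j # q" "j \<notin> set q"
    using j by (meson split_list_last)
  have pqn: "p \<in> lists {1..n}" "q \<in> lists {1..n}" "\<forall>y\<in>set q. y \<le> j"
    using pq less j by auto
  have "kiselman_class n (s @ [j]) = kiselman_class n ((s @ p) @ (j # q @ [j]))"
    using kiselman_class_cong[OF less(3), of "[]" "[j]"] assms(1) less.prems jn by (simp add: pq)
  also have "\<dots> = kiselman_class n ((s @ p) @ (j # q))"
    using kiselman_class_cong[OF kiselman_class_absorb_right[OF jn pqn(2,3)], of "s @ p" "[]"]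
      assms(1) jn pqn by simp
  also have "\<dots> = kiselman_class n s" using less.prems by (simp add: pq)
  finally have sj: "kiselman_class n (s @ [j]) = kiselman_class n s" .
  \<comment> \<open>As \<open>s\<close> absorbs \<open>j\<close>, a \<open>j\<close> may be written
    in front of \<open>t'\<close>; behind it the erased occurrences of \<open>j\<close> can be
    restored, which leads back to \<open>s t = s\<close>.\<close>
  have "kiselman_class n (s @ t') = kiselman_class n (s @ j # t')"
    using kiselman_class_cong[OF sj, of "[]" t'] assms(1) jn t' by simp
  also have "\<dots> = kiselman_class n (s @ j # t)"
    using kiselman_class_cong[OF kiselman_class_filter_right[OF jn less.prems(1) j(2)], of s "[]"]
      assms(1) jn less.prems by (simp add: t'_def)
  also have "\<dots> = kiselman_class n (s @ t)"
    using kiselman_class_cong[OF sj, of "[]" t] assms(1) jn less.prems by simp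
  finally have st': "kiselman_class n (s @ t') = kiselman_class n s" using less.prems by simp
  show ?case
  proof (cases "x = j")
    case True
    then show ?thesis using sj by simp
  next
    case False
    have "card (set t') < card (set t)" using j t' by (metis List.finite_set card_Diff1_less)
    then show ?thesis using less.hyps[of t'] t' st' False less.prems by auto
  qed
qed

lemma kiselman_class_fixed_by_content:
  assumes "s \<in> lists {1..n}" "t \<in> lists {1..n}"
    and "kiselman_class n (s @ t) = kiselman_class n s" and "set u \<subseteq> set t"
  shows "kiselman_class n (s @ u) = kiselman_class n s"
  using assms(4)
proof (induction u)
  case (Cons x u)
  then have x: "x \<in> set t" and u: "u \<in> lists {1..n}" "x \<in> {1..n}" using assms(2) by auto
  have "kiselman_class n (s @ x # u) = kiselman_class n (s @ u)"
    using kiselman_class_cong[OF kiselman_class_fixed_by_letters[OF assms(1-3) x], of "[]" u]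
      assms(1) u by simp
  then show ?case using Cons by simp
qed simp

section \<open>Semigroup algebras of finite monoids\<close>

lemma (in abelian_monoid) finsum_swap:
  assumes "finite A" "finite B" "\<And>a b. a \<in> A \<Longrightarrow> b \<in> B \<Longrightarrow> f a b \<in> carrier G"
  shows "(\<Oplus>a\<in>A. \<Oplus>b\<in>B. f a b) = (\<Oplus>b\<in>B. \<Oplus>a\<in>A. f a b)"
  using assms(1,3)
proof (induction A rule: finite_induct)
  case (insert x F)
  have "(\<Oplus>b\<in>B. \<Oplus>a\<in>insert x F. f a b) = (\<Oplus>b\<in>B. f x b \<oplus> (\<Oplus>a\<in>F. f a b))"
    using insert by (intro finsum_cong') (auto intro!: finsum_insert finsum_closed)
  also have "\<dots> = (\<Oplus>b\<in>B. f x b) \<oplus> (\<Oplus>b\<in>B. \<Oplus>a\<in>F. f a b)"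
    using insert by (intro finsum_addf) (auto intro!: finsum_closed)
  finally show ?case
    using insert by (subst finsum_insert) (auto intro!: finsum_closed)
qed (simp add: finsum_zero)

lemma (in abelian_monoid) finsum_cartesian:
  assumes "finite A" "finite B" "\<And>a b. a \<in> A \<Longrightarrow> b \<in> B \<Longrightarrow> f a b \<in> carrier G"
  shows "(\<Oplus>p\<in>A \<times> B. f (fst p) (snd p)) = (\<Oplus>a\<in>A. \<Oplus>b\<in>B. f a b)"
  using assms(1,3)
proof (induction A rule: finite_induct)
  case (insert x F)
  have eq: "insert x F \<times> B = Pair x ` B \<union> F \<times> B" by auto
  have "(\<Oplus>p\<in>Pair x ` B. f (fst p) (snd p)) = (\<Oplus>b\<in>B. f x b)"
    using insert by (subst finsum_reindex) (auto simp: inj_on_def)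
  then show ?case
    using insert assms(2) unfolding eq
    by (subst finsum_Un_disjoint) (auto intro!: finsum_closed finsum_insert[symmetric])
qed simp

section \<open>The algebra of a finite monoid, treated through linear extensions of functions on the
  monoid\<close>

locale finite_monoid_algebra = field K + S: monoid S
  for K :: "('k, 'm) ring_scheme" (structure) and S :: "('s, 'n) monoid_scheme" (structure) +
  assumes finite_monoid: "finite (carrier S)"
begin

abbreviation A where "A \<equiv> semigroup_algebra K S"

text \<open>Restricting \<open>F\<close> makes the congruence rule below free of side conditions.\<close>

definition pairing :: "('s \<Rightarrow> 'k) \<Rightarrow> ('s \<Rightarrow> 'k) \<Rightarrow> 'k" where
  "pairing f F = (\<Oplus>s\<in>carrier S. f s \<otimes> restrict F (carrier S) s)"

abbreviation indicat :: "bool \<Rightarrow> 'k" where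
  "indicat P \<equiv> (if P then \<one> else \<zero>)"

definition delta :: "'s \<Rightarrow> 's \<Rightarrow> 'k" where
  "delta s = (\<lambda>u\<in>carrier S. indicat (u = s))"

lemma carrier_A: "carrier A = carrier S \<rightarrow>\<^sub>E carrier K"
  by (simp add: semigroup_algebra_def finite_monoid)

lemma A_closed [simp]: "f \<in> carrier A \<Longrightarrow> s \<in> carrier S \<Longrightarrow> f s \<in> carrier K"
  by (auto simp: carrier_A)

lemma add_A: "s \<in> carrier S \<Longrightarrow> (f \<oplus>\<^bsub>A\<^esub> g) s = f s \<oplus> g s"
  and smult_A: "s \<in> carrier S \<Longrightarrow> (a \<odot>\<^bsub>A\<^esub> f) s = a \<otimes> f s"
  and zero_A: "s \<in> carrier S \<Longrightarrow> \<zero>\<^bsub>A\<^esub> s = \<zero>"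
  and one_A: "\<one>\<^bsub>A\<^esub> = delta \<one>\<^bsub>S\<^esub>"
  by (auto simp: semigroup_algebra_def delta_def)

lemma add_A_closed [simp]: "f \<in> carrier A \<Longrightarrow> g \<in> carrier A \<Longrightarrow> f \<oplus>\<^bsub>A\<^esub> g \<in> carrier A"
  and smult_A_closed [simp]: "a \<in> carrier K \<Longrightarrow> f \<in> carrier A \<Longrightarrow> a \<odot>\<^bsub>A\<^esub> f \<in> carrier A"
  and zero_A_closed [simp]: "\<zero>\<^bsub>A\<^esub> \<in> carrier A"
  unfolding carrier_A by (auto simp: semigroup_algebra_def)

lemma delta_closed [simp]: "delta s \<in> carrier A"
  unfolding carrier_A by (auto simp: delta_def)

lemma A_eqI:
  assumes "f \<in> carrier A" "g \<in> carrier A" "\<And>s. s \<in> carrier S \<Longrightarrow> f s = g s"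
  shows "f = g"
  using assms unfolding carrier_A by (rule PiE_ext)

lemma pairing_cong [cong]:
  assumes "f = f'" "\<And>s. s \<in> carrier S \<Longrightarrow> F s = F' s"
  shows "pairing f F = pairing f' F'"
  using assms by (simp add: pairing_def cong: restrict_cong)

lemma pairing_eq:
  assumes "f \<in> carrier S \<rightarrow> carrier K" "\<And>s. s \<in> carrier S \<Longrightarrow> F s \<in> carrier K"
  shows "pairing f F = (\<Oplus>s\<in>carrier S. f s \<otimes> F s)"
  unfolding pairing_def using assms by (intro finsum_cong') auto

lemma A_funcset: "f \<in> carrier A \<Longrightarrow> f \<in> carrier S \<rightarrow> carrier K"
  by auto

lemma pairing_closed [simp]:
  assumes "f \<in> carrier A" "\<And>s. s \<in> carrier S \<Longrightarrow> F s \<in> carrier K"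
  shows "pairing f F \<in> carrier K"
  unfolding pairing_def using assms by (intro finsum_closed) auto

lemma pairing_add_left:
  assumes "f \<in> carrier A" "g \<in> carrier A" "\<And>s. s \<in> carrier S \<Longrightarrow> F s \<in> carrier K"
  shows "pairing (f \<oplus>\<^bsub>A\<^esub> g) F = pairing f F \<oplus> pairing g F"
proof -
  have "pairing (f \<oplus>\<^bsub>A\<^esub> g) F = (\<Oplus>s\<in>carrier S. f s \<otimes> F s \<oplus> g s \<otimes> F s)"
    unfolding pairing_def using assms by (intro finsum_cong') (auto simp: add_A l_distr)
  then show ?thesis
    using assms by (simp add: pairing_eq A_funcset finsum_addf Pi_def)
qed

lemma pairing_add_right:
  assumes "f \<in> carrier A" "\<And>s. s \<in> carrier S \<Longrightarrow> F s \<in> carrier K"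
    "\<And>s. s \<in> carrier S \<Longrightarrow> G s \<in> carrier K"
  shows "pairing f (\<lambda>s. F s \<oplus> G s) = pairing f F \<oplus> pairing f G"
proof -
  have "pairing f (\<lambda>s. F s \<oplus> G s) = (\<Oplus>s\<in>carrier S. f s \<otimes> F s \<oplus> f s \<otimes> G s)"
    unfolding pairing_def using assms by (intro finsum_cong') (auto simp: r_distr)
  then show ?thesis
    using assms by (simp add: pairing_eq A_funcset finsum_addf Pi_def)
qed

lemma pairing_smult_left:
  assumes "a \<in> carrier K" "f \<in> carrier A" "\<And>s. s \<in> carrier S \<Longrightarrow> F s \<in> carrier K"
  shows "pairing (a \<odot>\<^bsub>A\<^esub> f) F = a \<otimes> pairing f F"
proof -
  have "pairing (a \<odot>\<^bsub>A\<^esub> f) F = (\<Oplus>s\<in>carrier S. a \<otimes> (f s \<otimes> F s))"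
    unfolding pairing_def using assms by (intro finsum_cong') (auto simp: smult_A m_assoc)
  then show ?thesis
    using assms finite_monoid by (simp add: pairing_eq A_funcset finsum_rdistr Pi_def)
qed

lemma pairing_smult_right:
  assumes "a \<in> carrier K" "f \<in> carrier A" "\<And>s. s \<in> carrier S \<Longrightarrow> F s \<in> carrier K"
  shows "pairing f (\<lambda>s. a \<otimes> F s) = a \<otimes> pairing f F"
proof -
  have "pairing f (\<lambda>s. a \<otimes> F s) = (\<Oplus>s\<in>carrier S. a \<otimes> (f s \<otimes> F s))"
    unfolding pairing_def using assms by (intro finsum_cong') (auto simp: m_lcomm)
  then show ?thesis
    using assms finite_monoid by (simp add: pairing_eq A_funcset finsum_rdistr Pi_def)
qed

lemma pairing_indicat:
  assumes "f \<in> carrier A" "s \<in> carrier S"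
  shows "pairing f (\<lambda>u. indicat (u = s)) = f s"
proof -
  have "pairing f (\<lambda>u. indicat (u = s)) = (\<Oplus>u\<in>carrier S. if s = u then f u else \<zero>)"
    unfolding pairing_def using assms by (intro finsum_cong') auto
  then show ?thesis
    using assms finite_monoid by (simp add: finsum_singleton A_funcset)
qed

lemma pairing_delta:
  assumes "s \<in> carrier S" "\<And>u. u \<in> carrier S \<Longrightarrow> F u \<in> carrier K"
  shows "pairing (delta s) F = F s"
proof -
  have "pairing (delta s) F = (\<Oplus>u\<in>carrier S. if s = u then F u else \<zero>)"
    unfolding pairing_def using assms by (intro finsum_cong') (auto simp: delta_def)
  then show ?thesis
    using assms finite_monoid by (simp add: finsum_singleton Pi_def)
qed

lemma pairing_swap:
  assumes "f \<in> carrier A" "g \<in> carrier A"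
    "\<And>u v. u \<in> carrier S \<Longrightarrow> v \<in> carrier S \<Longrightarrow> H u v \<in> carrier K"
  shows "pairing f (\<lambda>u. pairing g (\<lambda>v. H u v)) = pairing g (\<lambda>v. pairing f (\<lambda>u. H u v))"
proof -
  have "pairing f (\<lambda>u. pairing g (\<lambda>v. H u v))
      = (\<Oplus>u\<in>carrier S. \<Oplus>v\<in>carrier S. f u \<otimes> (g v \<otimes> H u v))"
    unfolding pairing_def using assms finite_monoid
    by (intro finsum_cong') (auto simp: finsum_rdistr Pi_def intro!: finsum_cong')
  also have "\<dots> = (\<Oplus>v\<in>carrier S. \<Oplus>u\<in>carrier S. f u \<otimes> (g v \<otimes> H u v))"
    using assms finite_monoid by (intro finsum_swap) auto
  also have "\<dots> = (\<Oplus>v\<in>carrier S. \<Oplus>u\<in>carrier S. g v \<otimes> (f u \<otimes> H u v))"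
    using assms by (intro finsum_cong') (auto intro!: finsum_cong' finsum_closed simp: m_lcomm)
  also have "\<dots> = pairing g (\<lambda>v. pairing f (\<lambda>u. H u v))"
    unfolding pairing_def using assms finite_monoid
    by (intro finsum_cong') (auto simp: finsum_rdistr Pi_def intro!: finsum_cong')
  finally show ?thesis .
qed

text \<open>Writing coefficients of a product as nested pairings turns computations with products
  into computations with linear functionals.\<close>

lemma mult_A:
  assumes "f \<in> carrier A" "g \<in> carrier A" "s \<in> carrier S"
  shows "(f \<otimes>\<^bsub>A\<^esub> g) s = pairing f (\<lambda>u. pairing g (\<lambda>v. indicat (u \<otimes>\<^bsub>S\<^esub> v = s)))"
proof -
  let ?h = "\<lambda>u v. f u \<otimes> (g v \<otimes> indicat (u \<otimes>\<^bsub>S\<^esub> v = s))"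
  have "(f \<otimes>\<^bsub>A\<^esub> g) s = (\<Oplus>p \<in> {p \<in> carrier S \<times> carrier S. f (fst p) \<noteq> \<zero> \<and> g (snd p) \<noteq> \<zero>
                   \<and> fst p \<otimes>\<^bsub>S\<^esub> snd p = s}. f (fst p) \<otimes> g (snd p))"
    using assms(3) by (simp add: semigroup_algebra_def)
  \<comment> \<open>The added pairs, outside the supports or with product different from
    \<open>s\<close>, contribute zero.\<close>
  also have "\<dots> = (\<Oplus>p\<in>carrier S \<times> carrier S. ?h (fst p) (snd p))"
    using assms finite_monoid by (intro add.finprod_mono_neutral_cong_left) auto
  also have "\<dots> = (\<Oplus>u\<in>carrier S. \<Oplus>v\<in>carrier S. ?h u v)"
    using assms finite_monoid by (intro finsum_cartesian) auto
  also have "\<dots> = pairing f (\<lambda>u. pairing g (\<lambda>v. indicat (u \<otimes>\<^bsub>S\<^esub> v = s)))"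
    unfolding pairing_def using assms finite_monoid
    by (intro finsum_cong') (auto simp: finsum_rdistr Pi_def intro!: finsum_cong')
  finally show ?thesis .
qed

lemma mult_A_closed [simp]:
  assumes "f \<in> carrier A" "g \<in> carrier A"
  shows "f \<otimes>\<^bsub>A\<^esub> g \<in> carrier A"
proof -
  have "(f \<otimes>\<^bsub>A\<^esub> g) s \<in> carrier K" if "s \<in> carrier S" for s
    using assms that by (simp add: mult_A)
  moreover have "f \<otimes>\<^bsub>A\<^esub> g \<in> extensional (carrier S)"
    by (simp add: semigroup_algebra_def)
  ultimately show ?thesis
    unfolding carrier_A by (auto simp: PiE_def)
qed

text \<open>The linear extension of \<open>F\<close>, taken on a product, is the bilinear extension
  of \<open>F (u v)\<close>. This reduces associativity and the unit laws of the algebra to those of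
  the monoid.\<close>

lemma pairing_mult:
  assumes "f \<in> carrier A" "g \<in> carrier A" "\<And>s. s \<in> carrier S \<Longrightarrow> F s \<in> carrier K"
  shows "pairing (f \<otimes>\<^bsub>A\<^esub> g) F = pairing f (\<lambda>u. pairing g (\<lambda>v. F (u \<otimes>\<^bsub>S\<^esub> v)))"
proof -
  \<comment> \<open>On a finite monoid, \<open>F\<close> cut off outside the carrier is itself an
    element of the algebra. Pairing is therefore symmetric, and the sum over \<open>s\<close> can be
    moved inwards until it meets the indicator.\<close>
  define F' where "F' = restrict F (carrier S)"
  have F': "F' \<in> carrier A" "\<And>s. s \<in> carrier S \<Longrightarrow> F' s = F s"
    using assms(3) by (auto simp: F'_def carrier_A)
  have comm: "pairing h F = pairing F' h" if "h \<in> carrier A" for h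
    unfolding pairing_def using that assms(3) F' by (intro finsum_cong') (auto simp: m_comm)
  have "pairing (f \<otimes>\<^bsub>A\<^esub> g) F
      = pairing F' (\<lambda>s. pairing f (\<lambda>u. pairing g (\<lambda>v. indicat (u \<otimes>\<^bsub>S\<^esub> v = s))))"
    using assms by (simp add: comm mult_A)
  also have "\<dots> = pairing f (\<lambda>u. pairing F' (\<lambda>s. pairing g (\<lambda>v. indicat (u \<otimes>\<^bsub>S\<^esub> v = s))))"
    using assms F' by (intro pairing_swap) auto
  also have "\<dots> = pairing f (\<lambda>u. pairing g (\<lambda>v. pairing F' (\<lambda>s. indicat (u \<otimes>\<^bsub>S\<^esub> v = s))))"
    using assms F' by (intro pairing_cong pairing_swap) auto
  also have "\<dots> = pairing f (\<lambda>u. pairing g (\<lambda>v. F (u \<otimes>\<^bsub>S\<^esub> v)))"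
    using F' pairing_indicat[OF F'(1)] by (simp add: eq_commute)
  finally show ?thesis .
qed

text \<open>Indicator functions pick out the coefficients, so they already separate elements.
  Admitting every \<open>F\<close> lets the algebra laws be verified with the pairing rules.\<close>

lemma A_eqI_pairing:
  assumes "f \<in> carrier A" "g \<in> carrier A"
    "\<And>F. (\<And>s. s \<in> carrier S \<Longrightarrow> F s \<in> carrier K) \<Longrightarrow> pairing f F = pairing g F"
  shows "f = g"
proof (rule A_eqI[OF assms(1,2)])
  fix s assume "s \<in> carrier S"
  then show "f s = g s"
    using assms(3)[of "\<lambda>u. indicat (u = s)"] pairing_indicat assms(1,2) by auto
qed

lemma unital_algebra_A: "unital_algebra K A"
proof -
  have "abelian_group A"
  proof (rule abelian_groupI)
    fix x assume x: "x \<in> carrier A"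
    show "\<exists>y\<in>carrier A. y \<oplus>\<^bsub>A\<^esub> x = \<zero>\<^bsub>A\<^esub>"
    proof
      show "(\<ominus> \<one>) \<odot>\<^bsub>A\<^esub> x \<in> carrier A" using x by simp
      then show "(\<ominus> \<one>) \<odot>\<^bsub>A\<^esub> x \<oplus>\<^bsub>A\<^esub> x = \<zero>\<^bsub>A\<^esub>"
        using x by (intro A_eqI) (auto simp: add_A smult_A zero_A l_minus l_neg)
    qed
  qed (auto intro!: A_eqI simp: add_A zero_A a_assoc, simp add: a_comm)
  moreover have "monoid A"
    by (rule monoidI)
      (auto intro!: A_eqI_pairing simp: one_A pairing_mult pairing_delta S.m_assoc)
  moreover have "ring_axioms A"
    by unfold_locales (auto intro!: A_eqI_pairing
      simp: pairing_mult pairing_add_left pairing_add_right)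
  ultimately have "ring A"
    by (simp add: ring_def)
  moreover have "module_axioms K A"
    by unfold_locales (auto intro!: A_eqI simp: smult_A add_A l_distr r_distr m_assoc)
  moreover have "unital_algebra_axioms K A"
    by unfold_locales (auto intro!: A_eqI_pairing
      simp: pairing_mult pairing_smult_left pairing_smult_right)
  ultimately show ?thesis
    using is_cring by (simp add: unital_algebra_def module_def ring_def)
qed

end

section \<open>The basis of monoid elements\<close>

context finite_monoid_algebra
begin

text \<open>Partial sums are truncations of \<open>f\<close>; with \<open>T\<close> arbitrary, this
  form carries the induction behind the basis expansion.\<close>

lemma A_finsum_delta:
  assumes "f \<in> carrier A" "T \<subseteq> carrier S"
  shows "(\<Oplus>\<^bsub>A\<^esub>s\<in>T. f s \<odot>\<^bsub>A\<^esub> delta s) = (\<lambda>s\<in>carrier S. if s \<in> T then f s else \<zero>)"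
proof -
  interpret A: unital_algebra K A by (rule unital_algebra_A)
  have "finite T" using assms(2) finite_monoid by (rule finite_subset)
  then show ?thesis
    using assms(2)
  proof (induction T rule: finite_induct)
    case empty
    have "\<zero>\<^bsub>A\<^esub> = (\<lambda>s\<in>carrier S. \<zero>)" by (simp add: semigroup_algebra_def)
    then show ?case by (simp cong: restrict_cong)
  next
    case (insert t T)
    let ?r = "\<lambda>T. \<lambda>s\<in>carrier S. if s \<in> T then f s else \<zero>"
    have r: "?r T \<in> carrier A" for T using assms(1) unfolding carrier_A by auto
    have "(\<Oplus>\<^bsub>A\<^esub>s\<in>insert t T. f s \<odot>\<^bsub>A\<^esub> delta s) = f t \<odot>\<^bsub>A\<^esub> delta t \<oplus>\<^bsub>A\<^esub> ?r T"
    proof -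
      have "(\<Oplus>\<^bsub>A\<^esub>s\<in>insert t T. f s \<odot>\<^bsub>A\<^esub> delta s)
          = f t \<odot>\<^bsub>A\<^esub> delta t \<oplus>\<^bsub>A\<^esub> (\<Oplus>\<^bsub>A\<^esub>s\<in>T. f s \<odot>\<^bsub>A\<^esub> delta s)"
        using insert.hyps insert.prems assms(1) by (intro A.finsum_insert) auto
      also have "(\<Oplus>\<^bsub>A\<^esub>s\<in>T. f s \<odot>\<^bsub>A\<^esub> delta s) = ?r T"
        using insert by blast
      finally show ?thesis .
    qed
    also have "\<dots> = ?r (insert t T)"
    proof (rule A_eqI)
      show "f t \<odot>\<^bsub>A\<^esub> delta t \<oplus>\<^bsub>A\<^esub> ?r T \<in> carrier A"
        using insert.prems assms(1) by (intro add_A_closed smult_A_closed delta_closed r A_closed) auto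
      show "?r (insert t T) \<in> carrier A" by (rule r)
      show "(f t \<odot>\<^bsub>A\<^esub> delta t \<oplus>\<^bsub>A\<^esub> ?r T) s = ?r (insert t T) s" if "s \<in> carrier S" for s
        using that insert.prems insert.hyps assms(1) by (auto simp: add_A smult_A delta_def)
    qed
    finally show ?case .
  qed
qed

lemma A_span:
  assumes "f \<in> carrier A"
  shows "f = (\<Oplus>\<^bsub>A\<^esub>s\<in>carrier S. f s \<odot>\<^bsub>A\<^esub> delta s)"
proof -
  have "(\<lambda>s\<in>carrier S. if s \<in> carrier S then f s else \<zero>) = f"
    using assms unfolding carrier_A by (auto simp: PiE_def extensional_def)
  then show ?thesis using A_finsum_delta[OF assms subset_refl] by simp
qed

lemma inj_on_delta: "inj_on delta (carrier S)"
proof (rule inj_onI)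
  fix s t assume st: "s \<in> carrier S" "t \<in> carrier S" and "delta s = delta t"
  then have "delta t s = delta s s" by simp
  then show "s = t"
    using st by (simp add: delta_def split: if_splits)
qed

lemma finite_dimensional_algebra_A: "finite_dimensional_algebra K A"
proof -
  interpret A: unital_algebra K A by (rule unital_algebra_A)
  have "\<exists>c\<in>delta ` carrier S \<rightarrow> carrier K. x = (\<Oplus>\<^bsub>A\<^esub>b\<in>delta ` carrier S. c b \<odot>\<^bsub>A\<^esub> b)"
    if x: "x \<in> carrier A" for x
  proof
    \<comment> \<open>Spanning coefficients have to be indexed by the basis vectors, hence the
      detour through the inverse of \<open>delta\<close>.\<close>
    let ?c = "x \<circ> the_inv_into (carrier S) delta"
    have c: "?c (delta s) = x s" if "s \<in> carrier S" for s
      using that by (simp add: the_inv_into_f_f[OF inj_on_delta])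
    then show "?c \<in> delta ` carrier S \<rightarrow> carrier K"
      using x by auto
    have "(\<Oplus>\<^bsub>A\<^esub>b\<in>delta ` carrier S. ?c b \<odot>\<^bsub>A\<^esub> b) = (\<Oplus>\<^bsub>A\<^esub>s\<in>carrier S. ?c (delta s) \<odot>\<^bsub>A\<^esub> delta s)"
      using x c by (intro A.finsum_reindex inj_on_delta) (auto simp del: o_apply)
    also have "\<dots> = (\<Oplus>\<^bsub>A\<^esub>s\<in>carrier S. x s \<odot>\<^bsub>A\<^esub> delta s)"
      using x c by (intro A.finsum_cong') (auto simp del: o_apply)
    finally show "x = (\<Oplus>\<^bsub>A\<^esub>b\<in>delta ` carrier S. ?c b \<odot>\<^bsub>A\<^esub> b)"
      using A_span[OF x] by simp
  qed
  then have "finite_dimensional_algebra_axioms K A"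
    using finite_monoid
    by (intro finite_dimensional_algebra_axioms.intro exI[of _ "delta ` carrier S"]) auto
  then show ?thesis
    by (simp add: finite_dimensional_algebra_def unital_algebra_A field_axioms)
qed

text \<open>A left ideal is closed under scalars because
  \<open>a \<odot> x = (a \<odot> 1) x\<close>; so it contains every linear combination of basis
  elements lying in it.\<close>

lemma left_ideal_memI:
  assumes "left_ideal I A" "f \<in> carrier A"
    and supp: "\<And>s. s \<in> carrier S \<Longrightarrow> f s \<noteq> \<zero> \<Longrightarrow> delta s \<in> I"
  shows "f \<in> I"
proof -
  interpret A: unital_algebra K A by (rule unital_algebra_A)
  interpret I: additive_subgroup I A using assms(1) by (simp add: left_ideal_def)
  have I: "f s \<odot>\<^bsub>A\<^esub> delta s \<in> I" if "s \<in> carrier S" for s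
  proof (cases "f s = \<zero>")
    case True
    then show ?thesis by simp
  next
    case False
    have "f s \<odot>\<^bsub>A\<^esub> delta s = (f s \<odot>\<^bsub>A\<^esub> \<one>\<^bsub>A\<^esub>) \<otimes>\<^bsub>A\<^esub> delta s"
      using assms(2) that by (simp add: A.smult_mult_left)
    then show ?thesis
      using assms(1,2) supp[OF that False] that by (simp add: left_ideal_def)
  qed
  have "(\<Oplus>\<^bsub>A\<^esub>s\<in>T. f s \<odot>\<^bsub>A\<^esub> delta s) \<in> I" if "finite T" "T \<subseteq> carrier S" for T
    using that
  proof (induction T rule: finite_induct)
    case (insert t T)
    then show ?case
      using assms(2) I by (subst A.finsum_insert) (auto intro: I.a_closed)
  qed simp
  then have "(\<Oplus>\<^bsub>A\<^esub>s\<in>carrier S. f s \<odot>\<^bsub>A\<^esub> delta s) \<in> I"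
    using finite_monoid by blast
  then show ?thesis
    by (simp only: A_span[OF assms(2), symmetric])
qed

end

text \<open>The axioms collect what the computation of the radical uses about Kiselman's semigroup.
  The last one makes membership in the right stabilizer of \<open>s\<close> a matter of
  contents.\<close>

locale content_monoid_algebra = finite_monoid_algebra K S
  for K :: "('k, 'm) ring_scheme" (structure) and S :: "('s, 'n) monoid_scheme" (structure) +
  fixes content :: "'s \<Rightarrow> 'c set"
  assumes content_one: "content \<one>\<^bsub>S\<^esub> = {}"
    and content_mult: "\<lbrakk>s \<in> carrier S; t \<in> carrier S\<rbrakk> \<Longrightarrow>
      content (s \<otimes>\<^bsub>S\<^esub> t) = content s \<union> content t"
    and fixed_by_content: "\<lbrakk>s \<in> carrier S; t \<in> carrier S; u \<in> carrier S;
      s \<otimes>\<^bsub>S\<^esub> t = s; content u \<subseteq> content t\<rbrakk> \<Longrightarrow> s \<otimes>\<^bsub>S\<^esub> u = s"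
begin

section \<open>Characters defined by the content\<close>

definition chi :: "'c set \<Rightarrow> ('s \<Rightarrow> 'k) \<Rightarrow> 'k" where
  "chi X f = pairing f (\<lambda>s. indicat (content s \<subseteq> X))"

lemma chi_closed [simp]: "f \<in> carrier A \<Longrightarrow> chi X f \<in> carrier K"
  by (simp add: chi_def)

lemma chi_add: "f \<in> carrier A \<Longrightarrow> g \<in> carrier A \<Longrightarrow> chi X (f \<oplus>\<^bsub>A\<^esub> g) = chi X f \<oplus> chi X g"
  by (simp add: chi_def pairing_add_left)

lemma chi_smult: "a \<in> carrier K \<Longrightarrow> f \<in> carrier A \<Longrightarrow> chi X (a \<odot>\<^bsub>A\<^esub> f) = a \<otimes> chi X f"
  by (simp add: chi_def pairing_smult_left)

lemma chi_delta: "s \<in> carrier S \<Longrightarrow> chi X (delta s) = indicat (content s \<subseteq> X)"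
  by (simp add: chi_def pairing_delta)

lemma chi_one: "chi X \<one>\<^bsub>A\<^esub> = \<one>"
  by (simp add: one_A chi_delta content_one)

text \<open>The content of \<open>u v\<close> lies in \<open>X\<close> exactly when those of
  \<open>u\<close> and \<open>v\<close> do, so the indicator is multiplicative and the double
  pairing factors.\<close>

lemma chi_mult:
  assumes "f \<in> carrier A" "g \<in> carrier A"
  shows "chi X (f \<otimes>\<^bsub>A\<^esub> g) = chi X f \<otimes> chi X g"
proof -
  have "chi X (f \<otimes>\<^bsub>A\<^esub> g)
      = pairing f (\<lambda>u. pairing g (\<lambda>v. indicat (content u \<subseteq> X) \<otimes> indicat (content v \<subseteq> X)))"
    unfolding chi_def using assms by (subst pairing_mult) (auto simp: content_mult intro!: pairing_cong)
  also have "\<dots> = pairing f (\<lambda>u. chi X g \<otimes> indicat (content u \<subseteq> X))"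
    unfolding chi_def using assms
    by (intro pairing_cong) (auto simp: pairing_smult_right m_comm simp del: r_one l_one r_null l_null)
  also have "\<dots> = chi X f \<otimes> chi X g"
    using assms by (subst pairing_smult_right) (auto simp: chi_def[symmetric] m_comm)
  finally show ?thesis .
qed

lemma chi_hom: "chi X \<in> ring_hom A K"
  by (rule ring_hom_memI) (simp_all add: chi_mult chi_add chi_one)

lemma chi_zero [simp]: "chi X \<zero>\<^bsub>A\<^esub> = \<zero>"
proof -
  interpret A: unital_algebra K A by (rule unital_algebra_A)
  interpret h: ring_hom_ring A K "chi X"
    by (intro ring_hom_ringI2 chi_hom A.ring_axioms ring_axioms)
  show ?thesis by simp
qed

lemma chi_minus: "f \<in> carrier A \<Longrightarrow> g \<in> carrier A \<Longrightarrow> chi X (f \<ominus>\<^bsub>A\<^esub> g) = chi X f \<ominus> chi X g"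
proof -
  interpret A: unital_algebra K A by (rule unital_algebra_A)
  interpret h: ring_hom_ring A K "chi X"
    by (intro ring_hom_ringI2 chi_hom A.ring_axioms ring_axioms)
  show "f \<in> carrier A \<Longrightarrow> g \<in> carrier A \<Longrightarrow> chi X (f \<ominus>\<^bsub>A\<^esub> g) = chi X f \<ominus> chi X g"
    by (simp add: A.minus_eq minus_eq)
qed

lemma maximal_left_ideal_kernel_chi:
  "maximal_left_ideal {f \<in> carrier A. chi X f = \<zero>} A" (is "maximal_left_ideal ?I A")
proof -
  interpret A: unital_algebra K A by (rule unital_algebra_A)
  interpret h: ring_hom_ring A K "chi X"
    by (intro ring_hom_ringI2 chi_hom A.ring_axioms ring_axioms)
  have "ideal ?I A"
    using h.kernel_is_ideal unfolding a_kernel_def' .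
  then have I: "left_ideal ?I A"
    by (simp add: left_ideal_def ideal_def ideal_axioms_def)
  have "\<one>\<^bsub>A\<^esub> \<notin> ?I" by (simp add: chi_one)
  then have "?I \<noteq> carrier A" using A.one_closed by blast
  moreover have "J = carrier A" if J: "left_ideal J A" "?I \<subseteq> J" "J \<noteq> ?I" for J
  proof -
    interpret J: additive_subgroup J A using J(1) by (simp add: left_ideal_def)
    obtain b where b: "b \<in> J" "b \<notin> ?I" using J by blast
    have b': "b \<in> carrier A" "chi X b \<noteq> \<zero>" using b J.a_subset by auto
    then have inv: "inv (chi X b) \<in> carrier K" "inv (chi X b) \<otimes> chi X b = \<one>"
      using field_Units by auto
    have "x \<in> J" if x: "x \<in> carrier A" for x
    proof -
      \<comment> \<open>This is the multiple of \<open>b\<close> on which \<open>chi X\<close> takes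
        the same value as on \<open>x\<close>; the difference lies in the kernel, hence in
        \<open>J\<close>. The scalar is applied to the unit because \<open>J\<close> is only known
        to absorb multiplication in the algebra.\<close>
      define y where "y = ((chi X x \<otimes> inv (chi X b)) \<odot>\<^bsub>A\<^esub> \<one>\<^bsub>A\<^esub>) \<otimes>\<^bsub>A\<^esub> b"
      have y: "y \<in> J" "y \<in> carrier A"
        using J(1) b b' inv x by (auto simp: left_ideal_def y_def)
      have "chi X y = chi X x"
        using x b' inv by (simp add: y_def chi_mult chi_smult chi_one m_assoc)
      then have "x \<ominus>\<^bsub>A\<^esub> y \<in> ?I"
        using x y by (simp add: chi_minus r_neg minus_eq)
      then have "(x \<ominus>\<^bsub>A\<^esub> y) \<oplus>\<^bsub>A\<^esub> y \<in> J" using J(2) y by (intro J.a_closed) auto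
      then show ?thesis using x y by (simp add: A.minus_eq A.a_assoc A.l_neg)
    qed
    then show ?thesis using J.a_subset by blast
  qed
  ultimately show ?thesis using I by (auto simp: maximal_left_ideal_def)
qed

section \<open>Stabilizers and the radical\<close>

lemma content_stabilizer:
  assumes s: "s \<in> carrier S"
  obtains t where "t \<in> carrier S"
    "\<And>u. u \<in> carrier S \<Longrightarrow> s \<otimes>\<^bsub>S\<^esub> u = s \<longleftrightarrow> content u \<subseteq> content t"
proof -
  \<comment> \<open>The right stabilizer of \<open>s\<close> is finite and closed under products, so
    multiplying its elements together yields one whose content contains all the others.\<close>
  define R where "R = {u \<in> carrier S. s \<otimes>\<^bsub>S\<^esub> u = s}"
  have "finite R" unfolding R_def using finite_monoid by simp
  moreover have "\<exists>t\<in>R. \<forall>u\<in>T. content u \<subseteq> content t" if "finite T" "T \<subseteq> R" for T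
    using that
  proof (induction T rule: finite_induct)
    case empty
    have "\<one>\<^bsub>S\<^esub> \<in> R" using s by (simp add: R_def)
    then show ?case by blast
  next
    case (insert x T)
    then obtain t where t: "t \<in> R" "\<forall>u\<in>T. content u \<subseteq> content t" by auto
    have "t \<otimes>\<^bsub>S\<^esub> x \<in> R"
      using t insert.prems s by (auto simp: R_def S.m_assoc[symmetric])
    moreover have "\<forall>u\<in>insert x T. content u \<subseteq> content (t \<otimes>\<^bsub>S\<^esub> x)"
      using t insert.prems content_mult[of t x] by (auto simp: R_def)
    ultimately show ?case by blast
  qed
  ultimately obtain t where t: "t \<in> R" "\<forall>u\<in>R. content u \<subseteq> content t" by blast
  have "s \<otimes>\<^bsub>S\<^esub> u = s \<longleftrightarrow> content u \<subseteq> content t" if "u \<in> carrier S" for u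
    using fixed_by_content[of s t u] t that s by (auto simp: R_def)
  then show thesis using that t by (auto simp: R_def)
qed

text \<open>
  The coefficient of \<open>delta s * b\<close> at \<open>s\<close> is a value \<open>chi X b = 0\<close>, and all other elements of
  its support generate strictly smaller right ideals of the monoid than \<open>s\<close> does.
\<close>

lemma delta_mem_left_ideal:
  assumes I: "left_ideal I A" and b: "b \<in> carrier A" "\<one>\<^bsub>A\<^esub> \<ominus>\<^bsub>A\<^esub> b \<in> I"
    and chi: "\<And>X. X \<in> content ` carrier S \<Longrightarrow> chi X b = \<zero>"
    and s: "s \<in> carrier S"
  shows "delta s \<in> I"
proof -
  interpret A: unital_algebra K A by (rule unital_algebra_A)
  interpret I: additive_subgroup I A using I by (simp add: left_ideal_def)
  \<comment> \<open>The right ideal \<open>s S\<close>, whose size is the induction measure.\<close>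
  define rng where "rng s = (\<lambda>u. s \<otimes>\<^bsub>S\<^esub> u) ` carrier S" for s
  show ?thesis using s
  proof (induction "card (rng s)" arbitrary: s rule: less_induct)
    case less
    obtain t where t: "t \<in> carrier S"
      "\<And>u. u \<in> carrier S \<Longrightarrow> s \<otimes>\<^bsub>S\<^esub> u = s \<longleftrightarrow> content u \<subseteq> content t"
      using content_stabilizer[OF less.prems] by blast
    define g where "g = delta s \<otimes>\<^bsub>A\<^esub> b"
    have g: "g \<in> carrier A" using b by (simp add: g_def)
    have g_eq: "g u = pairing b (\<lambda>v. indicat (s \<otimes>\<^bsub>S\<^esub> v = u))" if "u \<in> carrier S" for u
      using that b less.prems by (simp add: g_def mult_A pairing_delta)
    have "delta u \<in> I" if u: "u \<in> carrier S" "g u \<noteq> \<zero>" for u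
    proof -
      \<comment> \<open>At \<open>u = s\<close> the indicator of \<open>s v = s\<close> becomes that
        of \<open>content v \<subseteq> content t\<close>, so the coefficient is
        \<open>chi (content t) b\<close>.\<close>
      have "u \<noteq> s"
      proof
        assume "u = s"
        then have "g u = chi (content t) b"
          using g_eq[OF u(1)] t(2) by (simp add: chi_def)
        then show False using chi t(1) u(2) by simp
      qed
      have "\<exists>v\<in>carrier S. s \<otimes>\<^bsub>S\<^esub> v = u"
      proof (rule ccontr)
        assume "\<not> ?thesis"
        \<comment> \<open>The zero function is written as a product so that
          \<open>pairing_smult_right\<close> can extract the factor zero.\<close>
        then have "g u = pairing b (\<lambda>v. \<zero> \<otimes> \<zero>)"
          using g_eq[OF u(1)] by simp
        also have "\<dots> = \<zero>" using b by (subst pairing_smult_right) auto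
        finally show False using u(2) by simp
      qed
      then obtain v where v: "v \<in> carrier S" "u = s \<otimes>\<^bsub>S\<^esub> v" by blast
      have "rng u \<subseteq> rng s"
        using v less.prems by (auto simp: rng_def S.m_assoc)
      moreover have "s \<in> rng s"
        using less.prems by (auto simp: rng_def intro!: image_eqI[of _ _ "\<one>\<^bsub>S\<^esub>"])
      \<comment> \<open>From \<open>s v w = s\<close> the content of \<open>v w\<close>, and with it
        that of \<open>v\<close>, lies in \<open>content t\<close>; then \<open>s v = s\<close>,
        contrary to \<open>u \<noteq> s\<close>.\<close>
      moreover have "s \<notin> rng u"
      proof
        assume "s \<in> rng u"
        then obtain w where w: "w \<in> carrier S" "s \<otimes>\<^bsub>S\<^esub> (v \<otimes>\<^bsub>S\<^esub> w) = s"
          using v less.prems by (auto simp: rng_def S.m_assoc)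
        then have "content v \<subseteq> content t"
          using t(2)[of "v \<otimes>\<^bsub>S\<^esub> w"] v content_mult[of v w] by auto
        then show False using t(2)[of v] v \<open>u \<noteq> s\<close> by simp
      qed
      ultimately have "card (rng u) < card (rng s)"
        using finite_monoid by (intro psubset_card_mono) (auto simp: rng_def)
      then show ?thesis using less.hyps u(1) by blast
    qed
    then have gI: "g \<in> I" using left_ideal_memI[OF I g] by blast
    \<comment> \<open>Split \<open>delta s\<close> as \<open>delta s (1 - b) + delta s b\<close>:
      the first summand is in \<open>I\<close> because \<open>1 - b\<close> is, the second by
      induction.\<close>
    have "delta s \<otimes>\<^bsub>A\<^esub> (\<one>\<^bsub>A\<^esub> \<ominus>\<^bsub>A\<^esub> b) \<oplus>\<^bsub>A\<^esub> g \<in> I"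
      using I b gI by (auto simp: left_ideal_def intro!: I.a_closed)
    also have "delta s \<otimes>\<^bsub>A\<^esub> (\<one>\<^bsub>A\<^esub> \<ominus>\<^bsub>A\<^esub> b) \<oplus>\<^bsub>A\<^esub> g = delta s"
      using b by (simp add: g_def A.r_distr A.minus_eq A.r_minus A.a_assoc A.l_neg)
    finally show ?case .
  qed
qed

text \<open>One inclusion holds because kernels of characters are maximal left ideals. For the
  other, a maximal left ideal \<open>I\<close> missing \<open>b\<close> would satisfy
  \<open>I + A b = A\<close>, so some \<open>1 - a b\<close> lies in \<open>I\<close>; as the
  characters also kill \<open>a b\<close>, \<open>I\<close> would contain the whole basis.\<close>

lemma jacobson_radical_A:
  "jacobson_radical A = {f \<in> carrier A. \<forall>X\<in>content ` carrier S. chi X f = \<zero>}" (is "_ = ?N")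
proof
  show "jacobson_radical A \<subseteq> ?N"
    using maximal_left_ideal_kernel_chi by (fastforce simp: jacobson_radical_def)
  show "?N \<subseteq> jacobson_radical A"
  proof
    interpret A: unital_algebra K A by (rule unital_algebra_A)
    fix b assume b: "b \<in> ?N"
    have "b \<in> I" if max: "maximal_left_ideal I A" for I
    proof (rule ccontr)
      assume "b \<notin> I"
      have I: "left_ideal I A" using max by (simp add: maximal_left_ideal_def)
      interpret I: additive_subgroup I A using I by (simp add: left_ideal_def)
      define J where "J = {x \<oplus>\<^bsub>A\<^esub> a \<otimes>\<^bsub>A\<^esub> b | x a. x \<in> I \<and> a \<in> carrier A}"
      have bA: "b \<in> carrier A" using b by simp
      have IA: "x \<in> carrier A" if "x \<in> I" for x using that I.a_subset by blast
      have "left_ideal J A"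
        unfolding left_ideal_def
      proof (intro conjI ballI)
        show "additive_subgroup J A"
        proof (intro additive_subgroupI A.add.subgroupI)
          show "J \<subseteq> carrier A" using bA IA by (auto simp: J_def)
          have "\<zero>\<^bsub>A\<^esub> \<oplus>\<^bsub>A\<^esub> \<zero>\<^bsub>A\<^esub> \<otimes>\<^bsub>A\<^esub> b \<in> J"
            unfolding J_def using I.zero_closed A.zero_closed by blast
          then show "J \<noteq> {}" by blast
        next
          fix y assume "y \<in> J"
          then obtain x a where xa: "y = x \<oplus>\<^bsub>A\<^esub> a \<otimes>\<^bsub>A\<^esub> b" "x \<in> I" "a \<in> carrier A"
            by (auto simp: J_def)
          then have "\<ominus>\<^bsub>A\<^esub> y = \<ominus>\<^bsub>A\<^esub> x \<oplus>\<^bsub>A\<^esub> (\<ominus>\<^bsub>A\<^esub> a) \<otimes>\<^bsub>A\<^esub> b"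
            using bA IA by (simp add: A.minus_add A.l_minus)
          then show "\<ominus>\<^bsub>A\<^esub> y \<in> J"
            using xa I.a_inv_closed A.a_inv_closed unfolding J_def by blast
        next
          fix y z assume "y \<in> J" "z \<in> J"
          then obtain x a x' a' where xa: "y = x \<oplus>\<^bsub>A\<^esub> a \<otimes>\<^bsub>A\<^esub> b" "x \<in> I" "a \<in> carrier A"
            "z = x' \<oplus>\<^bsub>A\<^esub> a' \<otimes>\<^bsub>A\<^esub> b" "x' \<in> I" "a' \<in> carrier A"
            by (auto simp: J_def)
          then have "y \<oplus>\<^bsub>A\<^esub> z = (x \<oplus>\<^bsub>A\<^esub> x') \<oplus>\<^bsub>A\<^esub> (a \<oplus>\<^bsub>A\<^esub> a') \<otimes>\<^bsub>A\<^esub> b"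
            using bA IA by (simp add: A.l_distr A.a_ac)
          then show "y \<oplus>\<^bsub>A\<^esub> z \<in> J"
            using xa I.a_closed A.a_closed unfolding J_def by blast
        qed
      next
        fix c y assume c: "c \<in> carrier A" and "y \<in> J"
        then obtain x a where xa: "y = x \<oplus>\<^bsub>A\<^esub> a \<otimes>\<^bsub>A\<^esub> b" "x \<in> I" "a \<in> carrier A"
          by (auto simp: J_def)
        then have "c \<otimes>\<^bsub>A\<^esub> y = c \<otimes>\<^bsub>A\<^esub> x \<oplus>\<^bsub>A\<^esub> (c \<otimes>\<^bsub>A\<^esub> a) \<otimes>\<^bsub>A\<^esub> b"
          using bA IA c by (simp add: A.r_distr A.m_assoc)
        moreover have "c \<otimes>\<^bsub>A\<^esub> x \<in> I" using I c xa by (simp add: left_ideal_def)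
        ultimately show "c \<otimes>\<^bsub>A\<^esub> y \<in> J"
          using c xa A.m_closed unfolding J_def by blast
      qed
      moreover have "I \<subseteq> J"
      proof
        fix x assume x: "x \<in> I"
        then have "x = x \<oplus>\<^bsub>A\<^esub> \<zero>\<^bsub>A\<^esub> \<otimes>\<^bsub>A\<^esub> b" using bA IA by simp
        then show "x \<in> J" using x A.zero_closed unfolding J_def by blast
      qed
      moreover have "b \<in> J"
      proof -
        have "b = \<zero>\<^bsub>A\<^esub> \<oplus>\<^bsub>A\<^esub> \<one>\<^bsub>A\<^esub> \<otimes>\<^bsub>A\<^esub> b" using bA by simp
        then show ?thesis using I.zero_closed A.one_closed unfolding J_def by blast
      qed
      ultimately have "J = carrier A"
        using max \<open>b \<notin> I\<close> unfolding maximal_left_ideal_def by blast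
      then obtain x a where xa: "\<one>\<^bsub>A\<^esub> = x \<oplus>\<^bsub>A\<^esub> a \<otimes>\<^bsub>A\<^esub> b" "x \<in> I" "a \<in> carrier A"
        using A.one_closed unfolding J_def by blast
      have "\<one>\<^bsub>A\<^esub> \<ominus>\<^bsub>A\<^esub> a \<otimes>\<^bsub>A\<^esub> b = x"
        unfolding xa(1) using xa(2,3) bA IA by (simp add: A.minus_eq A.a_assoc A.r_neg)
      moreover have "chi X (a \<otimes>\<^bsub>A\<^esub> b) = \<zero>" if "X \<in> content ` carrier S" for X
      proof -
        have "chi X b = \<zero>" using b that by blast
        then show ?thesis using xa(3) bA by (simp add: chi_mult)
      qed
      ultimately have "delta s \<in> I" if "s \<in> carrier S" for s
        using delta_mem_left_ideal[OF I A.m_closed[OF xa(3) bA]] xa(2) that by simp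
      then show False
        using left_ideal_memI[OF I bA] \<open>b \<notin> I\<close> by blast
    qed
    then show "b \<in> jacobson_radical A"
      using b by (simp add: jacobson_radical_def)
  qed
qed

section \<open>Joint surjectivity of the characters\<close>

lemma chi_surj:
  assumes h: "h \<in> content ` carrier S \<rightarrow> carrier K"
  obtains f where "f \<in> carrier A" "\<And>X. X \<in> content ` carrier S \<Longrightarrow> chi X f = h X"
proof -
  interpret A: unital_algebra K A by (rule unital_algebra_A)
  let ?C = "content ` carrier S"
  have fin: "finite ?C" using finite_monoid by simp
  \<comment> \<open>Multiplying \<open>delta x\<close> by factors \<open>1 - delta t\<close>
    excludes the contents in \<open>T\<close> one by one: \<open>chi Z (1 - delta t)\<close> is
    \<open>0\<close> if \<open>content t\<close> lies in \<open>Z\<close>, and \<open>1\<close>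
    otherwise.\<close>
  have up: "\<exists>f\<in>carrier A. \<forall>Z. chi Z f = indicat (X \<subseteq> Z \<and> (\<forall>Y\<in>T. \<not> Y \<subseteq> Z))"
    if X: "X \<in> ?C" and T: "finite T" "T \<subseteq> ?C" for X T
    using T
  proof (induction T rule: finite_induct)
    case empty
    obtain x where "x \<in> carrier S" "X = content x" using X by blast
    then show ?case by (intro bexI[of _ "delta x"]) (auto simp: chi_delta)
  next
    case (insert Y T)
    then obtain f where f: "f \<in> carrier A"
      "\<And>Z. chi Z f = indicat (X \<subseteq> Z \<and> (\<forall>Y\<in>T. \<not> Y \<subseteq> Z))" by auto
    obtain t where t: "t \<in> carrier S" "content t = Y" using insert.prems by auto
    have "chi Z (f \<otimes>\<^bsub>A\<^esub> (\<one>\<^bsub>A\<^esub> \<ominus>\<^bsub>A\<^esub> delta t)) = indicat (X \<subseteq> Z \<and> (\<forall>Y\<in>insert Y T. \<not> Y \<subseteq> Z))" for Z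
      using f t by (simp add: chi_mult chi_minus chi_one chi_delta minus_eq r_neg)
    then show ?case using f(1) by (intro bexI[of _ "f \<otimes>\<^bsub>A\<^esub> (\<one>\<^bsub>A\<^esub> \<ominus>\<^bsub>A\<^esub> delta t)"]) auto
  qed
  have dual: "\<exists>f\<in>carrier A. \<forall>Z\<in>?C. chi Z f = indicat (Z = X)" if X: "X \<in> ?C" for X
  proof -
    \<comment> \<open>The excluded contents are those not inside \<open>X\<close>. If
      \<open>Z\<close> contains \<open>X\<close> and none of them, \<open>Z\<close> is not excluded
      itself, so \<open>Z \<subseteq> X\<close> and thus \<open>Z = X\<close>.\<close>
    have "finite {Y \<in> ?C. \<not> Y \<subseteq> X}" using fin by simp
    then obtain f where f: "f \<in> carrier A"
      "\<And>Z. chi Z f = indicat (X \<subseteq> Z \<and> (\<forall>Y\<in>{Y \<in> ?C. \<not> Y \<subseteq> X}. \<not> Y \<subseteq> Z))"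
      using up[OF X, of "{Y \<in> ?C. \<not> Y \<subseteq> X}"] by blast
    have "chi Z f = indicat (Z = X)" if "Z \<in> ?C" for Z
      unfolding f(2) using that by (intro if_cong) auto
    then show ?thesis using f(1) by blast
  qed
  \<comment> \<open>Values are prescribed on \<open>T\<close> and zero elsewhere, so that adding a
    scalar multiple of a dual element extends \<open>T\<close> by one content.\<close>
  have "\<exists>f\<in>carrier A. \<forall>Z\<in>?C. chi Z f = (if Z \<in> T then h Z else \<zero>)"
    if "finite T" "T \<subseteq> ?C" for T
    using that
  proof (induction T rule: finite_induct)
    case empty
    show ?case by (intro bexI[of _ "\<zero>\<^bsub>A\<^esub>"]) auto
  next
    case (insert X T)
    then obtain f where f: "f \<in> carrier A" "\<forall>Z\<in>?C. chi Z f = (if Z \<in> T then h Z else \<zero>)"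
      by auto
    have X: "X \<in> ?C" "h X \<in> carrier K" using h insert.prems by auto
    obtain g where g: "g \<in> carrier A" "\<forall>Z\<in>?C. chi Z g = indicat (Z = X)"
      using dual[OF X(1)] by (elim bexE)
    have "chi Z (f \<oplus>\<^bsub>A\<^esub> h X \<odot>\<^bsub>A\<^esub> g) = (if Z \<in> insert X T then h Z else \<zero>)" if Z: "Z \<in> ?C" for Z
    proof -
      have "chi Z f = (if Z \<in> T then h Z else \<zero>)" "chi Z g = indicat (Z = X)"
        "h Z \<in> carrier K"
        using f(2) g(2) h Z by blast+
      then show ?thesis
        using f(1) g(1) X(2) insert.hyps(2) by (simp add: chi_add chi_smult)
    qed
    then show ?case
      using f(1) g(1) X(2) by (intro bexI[of _ "f \<oplus>\<^bsub>A\<^esub> h X \<odot>\<^bsub>A\<^esub> g"]) auto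
  qed
  from this[OF fin subset_refl] obtain f where
    "f \<in> carrier A" "\<forall>Z\<in>?C. chi Z f = (if Z \<in> ?C then h Z else \<zero>)"
    by (elim bexE)
  then show thesis by (intro that[of f]) auto
qed

end

section \<open>The semisimple quotient\<close>

text \<open>
  The definition of \<^const>\<open>basic_algebra\<close> requires factors whose elements are sets of elements of
  the algebra, so a scalar \<open>k\<close> is encoded as the singleton of the constant function \<open>k\<close>.
\<close>

definition field_copy :: "('k, 'm) ring_scheme \<Rightarrow> ('k, ('s \<Rightarrow> 'k) set) module" where
  "field_copy K = (let \<iota> = (\<lambda>k. {\<lambda>_. k}); \<pi> = (\<lambda>x. the_elem x undefined) in
    \<lparr>carrier = \<iota> ` carrier K,
     mult = (\<lambda>x y. \<iota> (\<pi> x \<otimes>\<^bsub>K\<^esub> \<pi> y)),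
     one = \<iota> \<one>\<^bsub>K\<^esub>,
     zero = \<iota> \<zero>\<^bsub>K\<^esub>,
     add = (\<lambda>x y. \<iota> (\<pi> x \<oplus>\<^bsub>K\<^esub> \<pi> y)),
     smult = (\<lambda>a x. \<iota> (a \<otimes>\<^bsub>K\<^esub> \<pi> x))\<rparr>)"

text \<open>Evaluation at \<open>undefined\<close> decodes a constant function whatever that
  argument is, so on singletons of constants the operations are those of \<open>K\<close>.\<close>

lemma field_copy_simps:
  "carrier (field_copy K) = (\<lambda>k. {\<lambda>_. k}) ` carrier K"
  "{\<lambda>_. a} \<otimes>\<^bsub>field_copy K\<^esub> {\<lambda>_. b} = {\<lambda>_. a \<otimes>\<^bsub>K\<^esub> b}"
  "{\<lambda>_. a} \<oplus>\<^bsub>field_copy K\<^esub> {\<lambda>_. b} = {\<lambda>_. a \<oplus>\<^bsub>K\<^esub> b}"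
  "\<one>\<^bsub>field_copy K\<^esub> = {\<lambda>_. \<one>\<^bsub>K\<^esub>}"
  "\<zero>\<^bsub>field_copy K\<^esub> = {\<lambda>_. \<zero>\<^bsub>K\<^esub>}"
  "a \<odot>\<^bsub>field_copy K\<^esub> {\<lambda>_. b} = {\<lambda>_. a \<otimes>\<^bsub>K\<^esub> b}"
  by (simp_all add: field_copy_def)

lemma division_algebra_field_copy:
  fixes K :: "('k, 'm) ring_scheme" (structure)
  assumes "field K"
  shows "division_algebra K (field_copy K :: ('k, ('s \<Rightarrow> 'k) set) module)"
proof -
  interpret field K by fact
  let ?D = "field_copy K :: ('k, ('s \<Rightarrow> 'k) set) module"
  have "abelian_group ?D"
  proof (rule abelian_groupI)
    fix x assume "x \<in> carrier ?D"
    then obtain a where a: "a \<in> carrier K" "x = {\<lambda>_. a}" by (auto simp: field_copy_simps)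
    then show "\<exists>y\<in>carrier ?D. y \<oplus>\<^bsub>?D\<^esub> x = \<zero>\<^bsub>?D\<^esub>"
      by (intro bexI[of _ "{\<lambda>_. \<ominus> a}"]) (auto simp: field_copy_simps l_neg)
  qed (auto simp: field_copy_simps a_ac)
  moreover have "monoid ?D"
    by (rule monoidI) (auto simp: field_copy_simps m_assoc)
  moreover have "ring_axioms ?D"
    by unfold_locales (auto simp: field_copy_simps l_distr r_distr)
  ultimately have ring: "ring ?D" by (simp add: ring_def)
  moreover have "module_axioms K ?D"
    by unfold_locales (auto simp: field_copy_simps l_distr r_distr m_assoc)
  moreover have "unital_algebra_axioms K ?D"
    by unfold_locales (auto simp: field_copy_simps m_ac)
  ultimately have alg: "unital_algebra K ?D"
    using is_cring by (simp add: unital_algebra_def module_def ring_def)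
  have "Units ?D = carrier ?D - {\<zero>\<^bsub>?D\<^esub>}"
  proof (intro equalityI subsetI)
    fix x assume "x \<in> Units ?D"
    then obtain a b where "a \<in> carrier K" "b \<in> carrier K" "x = {\<lambda>_. a}" "b \<otimes> a = \<one>"
      by (auto simp: Units_def field_copy_simps fun_eq_iff)
    then show "x \<in> carrier ?D - {\<zero>\<^bsub>?D\<^esub>}"
      by (auto simp: field_copy_simps fun_eq_iff)
  next
    fix x assume "x \<in> carrier ?D - {\<zero>\<^bsub>?D\<^esub>}"
    then obtain a where a: "a \<in> carrier K" "a \<noteq> \<zero>" "x = {\<lambda>_. a}"
      by (auto simp: field_copy_simps)
    then have "a \<in> Units K" using field_Units by simp
    then have "inv a \<in> carrier K" "inv a \<otimes> a = \<one>" "a \<otimes> inv a = \<one>" by simp_all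
    then show "x \<in> Units ?D"
      using a unfolding Units_def
      by (auto simp: field_copy_simps intro!: bexI[of _ "inv a"])
  qed
  then show ?thesis
    using alg assms by (simp add: division_algebra_def division_algebra_axioms_def)
qed

section \<open>Products and quotients of algebras\<close>

lemma ring_product_algebra:
  assumes "\<And>i. i \<in> I \<Longrightarrow> ring (D i)"
  shows "ring (product_algebra I D)"
proof (rule ringI)
  have D: "abelian_group (D i)" "monoid (D i)" if "i \<in> I" for i
    using assms[OF that] by (auto simp: ring_def)
  show "abelian_group (product_algebra I D)"
  proof (rule abelian_groupI)
    fix x assume x: "x \<in> carrier (product_algebra I D)"
    show "\<exists>y\<in>carrier (product_algebra I D).
        y \<oplus>\<^bsub>product_algebra I D\<^esub> x = \<zero>\<^bsub>product_algebra I D\<^esub>"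
    proof -
      have "\<ominus>\<^bsub>D i\<^esub> x i \<in> carrier (D i)" "\<ominus>\<^bsub>D i\<^esub> x i \<oplus>\<^bsub>D i\<^esub> x i = \<zero>\<^bsub>D i\<^esub>" if "i \<in> I" for i
      proof -
        have "x i \<in> carrier (D i)" using x that by (auto simp: product_algebra_def)
        then show "\<ominus>\<^bsub>D i\<^esub> x i \<in> carrier (D i)" "\<ominus>\<^bsub>D i\<^esub> x i \<oplus>\<^bsub>D i\<^esub> x i = \<zero>\<^bsub>D i\<^esub>"
          using D(1)[OF that] by (simp_all add: abelian_group.l_neg abelian_group.a_inv_closed)
      qed
      then show ?thesis
        by (intro bexI[of _ "\<lambda>i\<in>I. \<ominus>\<^bsub>D i\<^esub> x i"])
          (auto simp: product_algebra_def intro!: restrict_ext)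
    qed
  next
    fix x assume x: "x \<in> carrier (product_algebra I D)"
    then show "\<zero>\<^bsub>product_algebra I D\<^esub> \<oplus>\<^bsub>product_algebra I D\<^esub> x = x"
      using assms
      by (auto simp: product_algebra_def ring.ring_simprules PiE_iff extensional_def fun_eq_iff)
  qed (use assms in \<open>auto simp: product_algebra_def ring.ring_simprules PiE_iff intro!: restrict_ext\<close>)
  show "monoid (product_algebra I D)"
  proof (rule monoidI)
    fix x assume x: "x \<in> carrier (product_algebra I D)"
    then show "\<one>\<^bsub>product_algebra I D\<^esub> \<otimes>\<^bsub>product_algebra I D\<^esub> x = x"
      using assms
      by (auto simp: product_algebra_def ring.ring_simprules PiE_iff extensional_def fun_eq_iff)
    show "x \<otimes>\<^bsub>product_algebra I D\<^esub> \<one>\<^bsub>product_algebra I D\<^esub> = x"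
      using x D(2)
      by (auto simp: product_algebra_def monoid.r_one PiE_iff extensional_def fun_eq_iff)
  qed (use assms in \<open>auto simp: product_algebra_def ring.ring_simprules PiE_iff intro!: restrict_ext\<close>)
qed (use assms in \<open>auto simp: product_algebra_def ring.ring_simprules PiE_iff intro!: restrict_ext\<close>)

text \<open>The isomorphism theorem for rings supplies the bijection; compatibility with scalars
  remains. As the scalar action on cosets is a union over representatives, this rests on
  \<open>h\<close> being constant on each coset.\<close>

lemma algebra_iso_quotient_kernel:
  assumes A: "unital_algebra K A" and B: "ring B" and h: "h \<in> ring_hom A B"
    and surj: "h ` carrier A = carrier B"
    and smult: "\<And>a x. \<lbrakk>a \<in> carrier K; x \<in> carrier A\<rbrakk> \<Longrightarrow> h (a \<odot>\<^bsub>A\<^esub> x) = a \<odot>\<^bsub>B\<^esub> h x"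
  shows "(\<lambda>X. the_elem (h ` X)) \<in> algebra_iso K (quotient_algebra A (a_kernel A B h)) B"
proof -
  interpret A: unital_algebra K A by fact
  interpret B: ring B by fact
  interpret h: ring_hom_ring A B h
    by (intro ring_hom_ringI2 h A.ring_axioms B)
  let ?I = "a_kernel A B h"
  interpret I: ideal ?I A by (rule h.kernel_is_ideal)
  let ?Q = "quotient_algebra A ?I"
  have Q: "carrier ?Q = carrier (A Quot ?I)" "mult ?Q = mult (A Quot ?I)"
    "add ?Q = add (A Quot ?I)" "one ?Q = one (A Quot ?I)"
    by (simp_all add: quotient_algebra_def ring.extend_def)
  have "(\<lambda>X. the_elem (h ` X)) \<in> ring_iso (A Quot ?I) B"
    using surj by (rule h.FactRing_iso_set)
  then have iso: "(\<lambda>X. the_elem (h ` X)) \<in> ring_iso ?Q B"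
    by (simp add: ring_iso_def ring_hom_def Q)
  have coset: "h y = h x" if y: "y \<in> ?I +>\<^bsub>A\<^esub> x" and x: "x \<in> carrier A" for x y
  proof -
    obtain i where "i \<in> ?I" "y = i \<oplus>\<^bsub>A\<^esub> x" using y unfolding a_r_coset_def' by blast
    moreover from this have "i \<in> carrier A" "h i = \<zero>\<^bsub>B\<^esub>" unfolding a_kernel_def' by auto
    ultimately show ?thesis using x by simp
  qed
  have "the_elem (h ` (a \<odot>\<^bsub>?Q\<^esub> X)) = a \<odot>\<^bsub>B\<^esub> the_elem (h ` X)"
    if a: "a \<in> carrier K" and X: "X \<in> carrier ?Q" for a X
  proof -
    obtain x where x: "x \<in> carrier A" "X = ?I +>\<^bsub>A\<^esub> x"
      using X by (auto simp: Q FactRing_def A_RCOSETS_def')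
    have XA: "X \<subseteq> carrier A" and xX: "x \<in> X"
      using x A.a_r_coset_subset_G[OF I.a_subset] I.a_rcos_self by auto
    have hX: "h ` X = {h x}" using coset x xX by blast
    have aX: "a \<odot>\<^bsub>?Q\<^esub> X = (\<Union>y\<in>X. ?I +>\<^bsub>A\<^esub> (a \<odot>\<^bsub>A\<^esub> y))"
      by (simp add: quotient_algebra_def ring.extend_def)
    have hz: "h z = a \<odot>\<^bsub>B\<^esub> h x" if z: "z \<in> a \<odot>\<^bsub>?Q\<^esub> X" for z
    proof -
      obtain y where y: "y \<in> X" "z \<in> ?I +>\<^bsub>A\<^esub> (a \<odot>\<^bsub>A\<^esub> y)" using z aX by blast
      then have "h z = h (a \<odot>\<^bsub>A\<^esub> y)" using a XA coset by blast
      also have "\<dots> = a \<odot>\<^bsub>B\<^esub> h y" using a XA y smult by blast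
      also have "h y = h x" using y x coset by blast
      finally show ?thesis .
    qed
    \<comment> \<open>This keeps the image computed below from being empty.\<close>
    have mem: "a \<odot>\<^bsub>A\<^esub> x \<in> a \<odot>\<^bsub>?Q\<^esub> X"
      using aX xX I.a_rcos_self[of "a \<odot>\<^bsub>A\<^esub> x"] a x by auto
    have "h ` (a \<odot>\<^bsub>?Q\<^esub> X) = {a \<odot>\<^bsub>B\<^esub> h x}"
    proof (intro equalityI subsetI)
      show "w \<in> h ` (a \<odot>\<^bsub>?Q\<^esub> X)" if "w \<in> {a \<odot>\<^bsub>B\<^esub> h x}" for w
        using imageI[OF mem, of h] hz[OF mem] that by simp
    qed (auto dest: hz)
    then show ?thesis using hX by simp
  qed
  then show ?thesis using iso by (auto simp: algebra_iso_def)
qed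

text \<open>The characters of the occurring contents are assembled into one map \<open>h\<close>
  onto a power of the field; its kernel is the radical, so the quotient is that power.\<close>

lemma (in content_monoid_algebra) basic_algebra_A: "basic_algebra K A"
proof -
  interpret A: unital_algebra K A by (rule unital_algebra_A)
  let ?C = "content ` carrier S"
  let ?D = "\<lambda>_ :: nat. field_copy K :: ('k, ('s \<Rightarrow> 'k) set) module"
  have "finite ?C" using finite_monoid by simp
  then obtain e where e: "bij_betw e {..<card ?C} ?C"
    using ex_bij_betw_nat_finite atLeast0LessThan by metis
  let ?m = "card ?C"
  let ?P = "product_algebra {..<?m} ?D"
  have eC: "e i \<in> ?C" if "i < ?m" for i
    using e that by (auto simp: bij_betw_def)
  define h where "h f = (\<lambda>i\<in>{..<?m}. {\<lambda>_ :: 's. chi (e i) f})" for f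
  have div: "division_algebra K (?D i)" for i
    by (rule division_algebra_field_copy) (rule field_axioms)
  then have ring: "ring ?P"
    by (intro ring_product_algebra) (simp add: division_algebra_def unital_algebra_def)
  have hom: "h \<in> ring_hom A ?P"
    by (rule ring_hom_memI)
      (auto simp: h_def product_algebra_def field_copy_simps chi_mult chi_add chi_one intro!: restrict_ext)
  have smult: "h (a \<odot>\<^bsub>A\<^esub> x) = a \<odot>\<^bsub>?P\<^esub> h x" if "a \<in> carrier K" "x \<in> carrier A" for a x
    using that by (auto simp: h_def product_algebra_def field_copy_simps chi_smult intro!: restrict_ext)
  have surj: "h ` carrier A = carrier ?P"
  proof
    show "h ` carrier A \<subseteq> carrier ?P" using hom by (auto simp: ring_hom_def)
    show "carrier ?P \<subseteq> h ` carrier A"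
    proof
      fix y assume y: "y \<in> carrier ?P"
      then have "\<forall>i\<in>{..<?m}. \<exists>k\<in>carrier K. y i = {\<lambda>_. k}"
        by (auto simp: product_algebra_def field_copy_simps PiE_iff)
      then obtain k where k: "\<And>i. i < ?m \<Longrightarrow> k i \<in> carrier K" "\<And>i. i < ?m \<Longrightarrow> y i = {\<lambda>_. k i}"
        by (metis lessThan_iff)
      \<comment> \<open>The prescribed values are indexed by numbers, while \<open>chi_surj\<close>
        wants them on contents; the inverse of \<open>e\<close> translates.\<close>
      let ?e' = "the_inv_into {..<?m} e"
      have inv: "?e' (e i) = i" if "i < ?m" for i
        using e that by (simp add: bij_betw_def the_inv_into_f_f)
      have "k \<circ> ?e' \<in> ?C \<rightarrow> carrier K"
      proof
        fix X assume "X \<in> ?C"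
        then have "X \<in> e ` {..<?m}" using e by (simp only: bij_betw_def)
        then obtain i where "i < ?m" "X = e i" by blast
        then show "(k \<circ> ?e') X \<in> carrier K" using inv k by simp
      qed
      then obtain f where f: "f \<in> carrier A" "\<And>X. X \<in> ?C \<Longrightarrow> chi X f = (k \<circ> ?e') X"
        using chi_surj by blast
      have "h f i = y i" if "i < ?m" for i
        using that f(2)[OF eC[OF that]] inv k by (simp add: h_def)
      moreover have "y \<in> extensional {..<?m}" "h f \<in> extensional {..<?m}"
        using y by (auto simp: product_algebra_def h_def PiE_iff)
      ultimately have "h f = y" by (intro extensionalityI) auto
      then show "y \<in> h ` carrier A" using f(1) by blast
    qed
  qed
  have zero: "h x = \<zero>\<^bsub>?P\<^esub> \<longleftrightarrow> (\<forall>i<?m. chi (e i) x = \<zero>)" for x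
  proof
    assume "h x = \<zero>\<^bsub>?P\<^esub>"
    then have eq: "h x i = \<zero>\<^bsub>?P\<^esub> i" for i by simp
    show "\<forall>i<?m. chi (e i) x = \<zero>"
    proof (intro allI impI)
      fix i assume "i < ?m"
      then show "chi (e i) x = \<zero>"
        using eq[of i] by (simp add: h_def product_algebra_def field_copy_simps fun_eq_iff)
    qed
  qed (auto simp: h_def product_algebra_def field_copy_simps intro!: restrict_ext)
  have "?C = e ` {..<?m}" using e by (simp add: bij_betw_def)
  then have "(\<forall>X\<in>?C. chi X x = \<zero>) \<longleftrightarrow> (\<forall>i<?m. chi (e i) x = \<zero>)" for x
    by (metis (no_types, lifting) imageE imageI lessThan_iff)
  then have rad: "jacobson_radical A = a_kernel A ?P h"
    unfolding jacobson_radical_A a_kernel_def' zero by blast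
  have "(\<lambda>X. the_elem (h ` X)) \<in> algebra_iso K (quotient_algebra A (jacobson_radical A)) ?P"
    unfolding rad by (intro algebra_iso_quotient_kernel unital_algebra_A ring hom surj smult)
  then have "(\<forall>i<?m. division_algebra K (?D i)) \<and>
      algebra_iso K (quotient_algebra A (jacobson_radical A)) (product_algebra {..<?m} ?D) \<noteq> {}"
    using div by blast
  then show ?thesis
    unfolding basic_algebra_def using finite_dimensional_algebra_A
    by (intro conjI exI[of _ ?m] exI[of _ ?D]) blast+
qed

section \<open>Kiselman's semigroup as an instance\<close>

lemma content_monoid_algebra_kiselman:
  assumes "field K"
  shows "content_monoid_algebra K (kiselman_monoid n) (\<lambda>A. \<Union> (set ` A))"
proof -
  have "monoid (kiselman_monoid n)"
    unfolding kiselman_monoid_def by (rule monoid_presented_monoid)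
  then have fin: "finite_monoid_algebra K (kiselman_monoid n)"
    using assms finite_carrier_kiselman_monoid
    by (simp add: finite_monoid_algebra_def finite_monoid_algebra_axioms_def)
  have "content_monoid_algebra_axioms (kiselman_monoid n) (\<lambda>A. \<Union> (set ` A))"
  proof
    show "\<Union> (set ` \<one>\<^bsub>kiselman_monoid n\<^esub>) = {}"
      using Union_set_kiselman_class[of "[]" n] by (simp add: one_kiselman_monoid)
  next
    fix s t assume "s \<in> carrier (kiselman_monoid n)" "t \<in> carrier (kiselman_monoid n)"
    then obtain u v where "u \<in> lists {1..n}" "v \<in> lists {1..n}"
      "s = kiselman_class n u" "t = kiselman_class n v"
      unfolding carrier_kiselman_monoid by blast
    then show "\<Union> (set ` (s \<otimes>\<^bsub>kiselman_monoid n\<^esub> t)) = \<Union> (set ` s) \<union> \<Union> (set ` t)"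
      using Union_set_kiselman_class[of "u @ v" n] Union_set_kiselman_class[of u n]
        Union_set_kiselman_class[of v n]
      by (simp only: kiselman_class_mult append_in_lists_conv set_append simp_thms)
  next
    fix s t w assume "s \<in> carrier (kiselman_monoid n)" "t \<in> carrier (kiselman_monoid n)"
      "w \<in> carrier (kiselman_monoid n)" and *: "s \<otimes>\<^bsub>kiselman_monoid n\<^esub> t = s"
      "\<Union> (set ` w) \<subseteq> \<Union> (set ` t)"
    then obtain p q r where p: "p \<in> lists {1..n}" "s = kiselman_class n p"
      and q: "q \<in> lists {1..n}" "t = kiselman_class n q"
      and r: "r \<in> lists {1..n}" "w = kiselman_class n r"
      unfolding carrier_kiselman_monoid by blast
    have "kiselman_class n (p @ q) = kiselman_class n p"
      using *(1) unfolding p(2) q(2) kiselman_class_mult[OF p(1) q(1)] .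
    moreover have "set r \<subseteq> set q"
      using *(2) unfolding q(2) r(2) Union_set_kiselman_class[OF q(1)]
        Union_set_kiselman_class[OF r(1)] .
    ultimately show "s \<otimes>\<^bsub>kiselman_monoid n\<^esub> w = s"
      using kiselman_class_fixed_by_content[OF p(1) q(1)]
      unfolding p(2) r(2) kiselman_class_mult[OF p(1) r(1)] by blast
  qed
  with fin show ?thesis by (simp add: content_monoid_algebra_def)
qed

theorem corollary37:
  fixes K :: "('k, 'm) ring_scheme" and n :: nat
  assumes "field K" and "n \<ge> 1"
  shows "basic_algebra K (semigroup_algebra K (kiselman_monoid n))"
  using content_monoid_algebra.basic_algebra_A[OF content_monoid_algebra_kiselman[OF assms(1)]] .

end
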